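(* Let $\lambda>-1$, and let $\alpha_n(t;\lambda)$, $\beta_n(t;\lambda)$ be the recurrence coefficients of the monic orthogonal polynomials for the generalised Airy weight $\omega(x;t,\lambda)=x^{\lambda}\exp(-\tfrac13x^3+tx)$ on $(0,\infty)$, with $t\in\mathbb{R}$. As $t\to\infty$, the recurrence coefficients $\alpha_n(t;\lambda)$ and $\beta_n(t;\lambda)$ have the formal asymptotic expansions $$\alpha_n(t;\lambda)=\sqrt{t}-\frac{2n-2\lambda+1}{4t}+\mathcal{O}(t^{-5/2}),\qquad \beta_n(t;\lambda)=\frac{n}{2\sqrt{t}}+\frac{n(n-2\lambda)}{4t^2}+\mathcal{O}(t^{-7/2}).$$ As $t\to-\infty$, the recurrence coefficients $\alpha_n(t;\lambda)$ and $\beta_n(t;\lambda)$ have the formal asymptotic expansions $$\alpha_n(t;\lambda)=-\frac{2n+\lambda+1}{t}-\frac{(2n+\lambda+1)(10n^2+10n\lambda+\lambda^2+10n+5\lambda+6)}{t^4}+\mathcal{O}(t^{-7}),$$ $$\beta_n(t;\lambda)=\frac{n(n+\lambda)}{t^2}+\frac{4n(n+\lambda)(5n^2+5n\lambda+\lambda^2+1)}{t^5}+\mathcal{O}(t^{-8}).$$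
   Context: The monic orthogonal polynomials $P_n(x)=P_n(x;t,\lambda)$ ($\deg P_n=n$) satisfy $\int_0^\infty P_m(x)P_n(x)\,x^{\lambda}\exp(-\tfrac13x^3+tx)\,\mathrm{d}x=0$ for $m\ne n$. The recurrence coefficients are defined by $xP_n(x)=P_{n+1}(x)+\alpha_n(t;\lambda)P_n(x)+\beta_n(t;\lambda)P_{n-1}(x)$ with $P_{-1}=0$, $P_0=1$, and $\beta_0=0$. The expansions are claimed only as formal asymptotic expansions. *)

theory Defs
  imports "HOL-Analysis.Analysis" "HOL-Library.Landau_Symbols" "HOL-Computational_Algebra.Polynomial"
begin

definition gen_airy_weight :: "real \<Rightarrow> real \<Rightarrow> real \<Rightarrow> real" where
  "gen_airy_weight t lam x = x powr lam * exp (- (x ^ 3 / 3) + t * x)"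

text \<open>
  The Bochner integral is 0 for non-integrable functions; for \<open>lam > -1\<close> every polynomial times
  \<^const>\<open>gen_airy_weight\<close> is integrable on the half-line, so the orthogonality relation is genuine.
\<close>
definition monic_orthogonal_polys :: "(real \<Rightarrow> real) \<Rightarrow> (nat \<Rightarrow> real poly) \<Rightarrow> bool" where
  "monic_orthogonal_polys w P \<longleftrightarrow>
     (\<forall>n. degree (P n) = n \<and> lead_coeff (P n) = 1) \<and>
     (\<forall>m n. m \<noteq> n \<longrightarrow> (LINT x:{0<..}|lborel. poly (P m) x * poly (P n) x * w x) = 0)"

text \<open>The conditional encodes the convention that the polynomial of index \<open>-1\<close> is 0.\<close>
definition recurrence_coeffs ::
    "(nat \<Rightarrow> real poly) \<Rightarrow> (nat \<Rightarrow> real) \<Rightarrow> (nat \<Rightarrow> real) \<Rightarrow> bool" where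
  "recurrence_coeffs P a b \<longleftrightarrow>
     P 0 = 1 \<and> b 0 = 0 \<and>
     (\<forall>n. [:0, 1:] * P n =
            P (Suc n) + smult (a n) (P n) + smult (b n) (if n = 0 then 0 else P (n - 1)))"

end

theory Submission
  imports Defs "HOL-Probability.Distributions" "HOL-Real_Asymp.Real_Asymp"
begin

text \<open>
  The weight \<open>w(x) = x\<^sup>\<lambda> exp(-x\<^sup>3/3 + t x)\<close> satisfies the Pearson equation
  \<open>(x w)' = (\<lambda> + 1 + t x - x\<^sup>3) w\<close>. Integrating the derivatives of \<open>x P\<^sub>n\<^sup>2 w\<close> and of
  \<open>x P\<^sub>n P\<^sub>n\<^sub>+\<^sub>1 w\<close> over the half-line gives two algebraic relations between the recurrence
  coefficients, the string equations (\<open>string_diag\<close>, \<open>string_offdiag\<close>). Together with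
  \<open>\<alpha>\<^sub>n > 0\<close> and \<open>\<beta>\<^sub>n > 0\<close>, which hold because the support is \<open>(0, \<infinity>)\<close>, they carry almost
  the whole proof: after rescaling to a small parameter \<open>e\<close>, a crude bound on the coefficients
  is fed into the equations, comes out one order better, and two rounds of this give the
  expansions with the stated remainders.

  For \<open>t \<rightarrow> -\<infinity>\<close> the weight looks like the Laguerre weight \<open>x\<^sup>\<lambda> exp(t x)\<close>. With
  \<open>A\<^sub>n = -t \<alpha>\<^sub>n\<close>, \<open>B\<^sub>n = t\<^sup>2 \<beta>\<^sub>n\<close> and \<open>e = -1/t\<^sup>3\<close> the equations read
  \<open>A\<^sub>n + e (...) = 2 n + \<lambda> + 1\<close> and \<open>\<Sum>A\<^sub>k = B\<^sub>n + e B\<^sub>n (...)\<close>, where all omitted terms are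
  nonnegative. Positivity alone bounds \<open>A\<^sub>n\<close> and \<open>B\<^sub>n\<close>, and the equations do the rest.

  For \<open>t \<rightarrow> \<infinity>\<close> the weight concentrates at the saddle point \<open>x = sqrt t\<close> and looks like a
  Hermite weight there. With \<open>y\<^sub>n = \<alpha>\<^sub>n / sqrt t\<close>, \<open>g\<^sub>n = \<beta>\<^sub>n / t\<close> and \<open>e = t\<^sup>-\<^sup>3\<^sup>/\<^sup>2\<close> the equations
  become \<open>y\<^sub>n\<^sup>3 - y\<^sub>n + g\<^sub>n (...) + g\<^sub>n\<^sub>+\<^sub>1 (...) = e (2 n + \<lambda> + 1)\<close> and
  \<open>e \<Sum>y\<^sub>k + g\<^sub>n = g\<^sub>n (...)\<close>. They do not force \<open>y\<^sub>n \<rightarrow> 1\<close>, since \<open>y\<^sub>n \<rightarrow> 0\<close> would be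
  consistent with them to leading order, and one estimate on the weight is required
  (\<open>weight_integral_concentration\<close>): the \<open>2n\<close>-th moment about the saddle is
  \<open>O(t\<^sup>-\<^sup>n\<^sup>/\<^sup>2)\<close> relative to the total mass. As \<open>\<beta>\<^sub>1 ... \<beta>\<^sub>n\<close> is the minimum over monic polynomials of
  degree \<open>n\<close> of the relative mean square, this yields
  \<open>g\<^sub>1 ... g\<^sub>n = O(e\<^sup>n)\<close>. The second equation gives a lower bound of order \<open>e\<close> for every
  single \<open>g\<^sub>k\<close>, hence each \<open>g\<^sub>n\<close> is exactly of order \<open>e\<close>. Now the first equation says that
  \<open>y\<^sub>n\<close> is close to 0 or 1, and the second one, by induction on \<open>n\<close>, excludes 0.
\<close>

section \<open>The string equations\<close>

text \<open>
  A separate constant for the polynomial \<open>x\<close> keeps the simplifier from turning products with it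
  into \<^const>\<open>pCons\<close> terms.
\<close>
definition X :: "real poly" where "X = [:0, 1:]"

lemma poly_X [simp]: "poly X x = x"
  by (simp add: X_def)

lemma X_mult_conv: "X * p = pCons 0 p"
  by (simp add: X_def)

text \<open>
  If \<open>J\<close> is the Jacobi matrix of the monic recurrence \<open>x P\<^sub>n = P\<^sub>n\<^sub>+\<^sub>1 + a\<^sub>n P\<^sub>n + b\<^sub>n P\<^sub>n\<^sub>-\<^sub>1\<close>, then
  \<open>cubic_diag a b n\<close> is the diagonal entry \<open>(J\<^sup>3)\<^sub>n\<^sub>,\<^sub>n\<close> and \<open>b\<^sub>m\<^sub>+\<^sub>1\<close> times
  \<open>cubic_offdiag a b m\<close> is the subdiagonal entry \<open>(J\<^sup>3)\<^sub>m\<^sub>+\<^sub>1\<^sub>,\<^sub>m\<close>. The truncated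
  \<open>n - 1\<close> at \<open>n = 0\<close> is harmless because it is multiplied by \<open>b\<^sub>0 = 0\<close>.
\<close>
definition cubic_diag :: "(nat \<Rightarrow> real) \<Rightarrow> (nat \<Rightarrow> real) \<Rightarrow> nat \<Rightarrow> real" where
  "cubic_diag a b n = a n ^ 3 + b n * (2 * a n + a (n - 1)) + b (Suc n) * (2 * a n + a (Suc n))"

definition cubic_offdiag :: "(nat \<Rightarrow> real) \<Rightarrow> (nat \<Rightarrow> real) \<Rightarrow> nat \<Rightarrow> real" where
  "cubic_offdiag a b m =
     a (Suc m) ^ 2 + a (Suc m) * a m + a m ^ 2 + b (Suc (Suc m)) + b (Suc m) + b m"

lemma cubic_diag_scale:
  "cubic_diag (\<lambda>k. s * a k) (\<lambda>k. s\<^sup>2 * b k) n = s ^ 3 * cubic_diag a b n"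
  by (simp add: cubic_diag_def power_mult_distrib algebra_simps power2_eq_square power3_eq_cube)

lemma cubic_offdiag_scale:
  "cubic_offdiag (\<lambda>k. s * a k) (\<lambda>k. s\<^sup>2 * b k) m = s\<^sup>2 * cubic_offdiag a b m"
  by (simp add: cubic_offdiag_def power_mult_distrib algebra_simps power2_eq_square)

text \<open>
  The algebra uses only a linear functional that is positive on the half-line and satisfies
  the Pearson identity, so it is carried out for an abstract \<open>L\<close>.
\<close>
locale airy_functional =
  fixes L :: "real poly \<Rightarrow> real" and t lam :: real
    and P :: "nat \<Rightarrow> real poly" and a b :: "nat \<Rightarrow> real"
  assumes L_add: "L (p + q) = L p + L q"
    and L_smult: "L (smult c p) = c * L p"
    and L_pos: "\<lbrakk>q \<noteq> 0; \<And>x. x > 0 \<Longrightarrow> poly q x \<ge> 0\<rbrakk> \<Longrightarrow> L q > 0"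
    and pearson: "L ([:lam + 1, t, 0, -1:] * p + X * pderiv p) = 0"
    and deg_P: "degree (P n) = n" and lead_P: "lead_coeff (P n) = 1"
    and orth: "m \<noteq> n \<Longrightarrow> L (P m * P n) = 0"
    and rec: "recurrence_coeffs P a b"
begin

definition h :: "nat \<Rightarrow> real" where "h n = L (P n * P n)"

lemma L_0 [simp]: "L 0 = 0"
  using L_smult[of 0 0] by simp

lemma L_minus: "L (- p) = - L p"
  using L_smult[of "-1" p] by simp

lemma L_diff: "L (p - q) = L p - L q"
  using L_add[of p "- q"] by (simp add: L_minus)

lemmas L_lin = L_add L_smult L_diff L_minus

lemma b_0: "b 0 = 0" and P_0: "P 0 = 1"
  using rec unfolding recurrence_coeffs_def by blast+

lemma three_term: "X * P n = P (Suc n) + smult (a n) (P n) + smult (b n) (P (n - 1))"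
proof (cases n)
  case 0
  have "X * P 0 = P (Suc 0) + smult (a 0) (P 0) + smult (b 0) (if (0::nat) = 0 then 0 else P (0 - 1))"
    using rec unfolding recurrence_coeffs_def X_def by blast
  then show ?thesis by (simp add: 0 b_0)
next
  case (Suc m)
  have "X * P n = P (Suc n) + smult (a n) (P n) + smult (b n) (if n = 0 then 0 else P (n - 1))"
    using rec unfolding recurrence_coeffs_def X_def by blast
  then show ?thesis by (simp add: Suc)
qed

lemma coeff_P: "coeff (P n) n = 1" "i > n \<Longrightarrow> coeff (P n) i = 0"
  using lead_P[of n] unfolding deg_P by (simp_all add: coeff_eq_0 deg_P)

lemma h_pos: "h n > 0"
proof -
  have "P n \<noteq> 0" using lead_P[of n] by auto
  then show ?thesis unfolding h_def by (intro L_pos) auto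
qed

lemma orth_lower:
  assumes "\<And>i. i \<ge> m \<Longrightarrow> coeff q i = 0" "m \<le> n"
  shows "L (q * P n) = 0"
  using assms
proof (induction m arbitrary: q)
  case 0
  then have "q = 0" by (simp add: poly_eq_iff)
  then show ?case by simp
next
  case (Suc m)
  define r where "r = q - smult (coeff q m) (P m)"
  have "coeff r i = 0" if "i \<ge> m" for i
    using that Suc.prems(1)[of i] coeff_P(1)[of m] coeff_P(2)[of m i]
    by (cases "i = m") (auto simp: r_def)
  then have "L (r * P n) = 0" using Suc by simp
  moreover have "q = r + smult (coeff q m) (P m)" by (simp add: r_def)
  then have "L (q * P n) = L (r * P n) + coeff q m * L (P m * P n)"
  proof -
    assume "q = r + smult (coeff q m) (P m)"
    from arg_cong[OF this, of "\<lambda>p. L (p * P n)"] show ?thesis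
      by (simp only: L_add L_smult distrib_right mult_smult_left)
  qed
  ultimately show ?case using orth[of m n] Suc.prems by simp
qed

lemma h_Suc: "b (Suc n) * h n = h (Suc n)"
proof -
  have "L (X * P (Suc n) * P n) = b (Suc n) * h n"
    unfolding three_term by (simp add: h_def distrib_right L_lin orth)
  moreover have "L (X * P n * P (Suc n)) = h (Suc n)"
    unfolding three_term by (simp add: h_def distrib_right L_lin orth)
  moreover have "X * P (Suc n) * P n = X * P n * P (Suc n)" by (simp only: ac_simps)
  ultimately show ?thesis by simp
qed

lemma b_pos: "b (Suc n) > 0"
proof -
  have "b (Suc n) * h n > 0" unfolding h_Suc by (rule h_pos)
  then show ?thesis using h_pos[of n] by (simp add: zero_less_mult_iff)
qed

lemma b_nonneg: "b n \<ge> 0"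
  using less_imp_le[OF b_pos] b_0 by (cases n) auto

lemma L_X_diag: "L (X * (P n * P n)) = a n * h n"
proof -
  have "L (X * P n * P n) = a n * h n"
    unfolding three_term using b_0 by (cases n) (simp_all add: h_def distrib_right L_lin orth)
  then show ?thesis by (simp add: mult.assoc)
qed

lemma L_X_next: "L (X * (P n * P (Suc n))) = h (Suc n)"
proof -
  have "L (X * P n * P (Suc n)) = h (Suc n)"
    unfolding three_term by (simp add: h_def distrib_right L_lin orth)
  then show ?thesis by (simp add: mult.assoc)
qed

lemma L_X_far: "m \<ge> n + 2 \<Longrightarrow> L (X * (P n * P m)) = 0"
proof -
  assume "m \<ge> n + 2"
  then have "L (X * P n * P m) = 0"
    unfolding three_term by (simp add: distrib_right L_lin orth)
  then show ?thesis by (simp add: mult.assoc)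
qed

lemma a_pos: "a n > 0"
proof -
  have "P n \<noteq> 0" "X \<noteq> 0" using lead_P[of n] by (auto simp: X_def)
  then have "L (X * (P n * P n)) > 0" by (intro L_pos) auto
  then show ?thesis using L_X_diag[of n] h_pos[of n] by (simp add: zero_less_mult_iff)
qed

lemma L_X_swap: "L (X * (p * q)) = L (X * (q * p))"
  by (simp add: mult.commute)

lemma L_X3_diag:
  "L (X * (X * (X * (P n * P n)))) = cubic_diag a b n * h n"
proof (cases n)
  case 0
  have "X * (X * (X * (P 0 * P 0))) = X * ((X * P 0) * (X * P 0))" by (simp only: ac_simps)
  then show ?thesis unfolding 0 cubic_diag_def
    by (simp add: three_term b_0 distrib_left distrib_right L_lin L_X_diag L_X_next
        L_X_swap[of "P (Suc 0)" "P 0"])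
       (simp add: algebra_simps power3_eq_cube flip: h_Suc)
next
  case (Suc m)
  have hm: "h (Suc m) = b (Suc m) * h m" "h (Suc (Suc m)) = b (Suc (Suc m)) * b (Suc m) * h m"
    by (simp_all flip: h_Suc)
  have "X * (X * (X * (P n * P n))) = X * ((X * P n) * (X * P n))" by (simp only: ac_simps)
  then show ?thesis unfolding three_term Suc cubic_diag_def
    by (simp add: distrib_left distrib_right L_lin L_X_diag L_X_next L_X_far
        L_X_swap[of "P (Suc (Suc m))" "P (Suc m)"] L_X_swap[of "P (Suc m)" "P m"]
        L_X_swap[of "P (Suc (Suc m))" "P m"])
       (simp add: hm algebra_simps power3_eq_cube)
qed

lemma L_X3_next:
  "L (X * (X * (X * (P m * P (Suc m))))) =
     b (Suc m) * cubic_offdiag a b m * h m"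
proof -
  have hm: "h (Suc m) = b (Suc m) * h m" "h (Suc (Suc m)) = b (Suc (Suc m)) * b (Suc m) * h m"
    by (simp_all flip: h_Suc)
  have *: "X * (X * (X * (P m * P (Suc m)))) = X * ((X * P m) * (X * P (Suc m)))" by (simp only: ac_simps)
  show ?thesis
  proof (cases m)
    case 0
    show ?thesis unfolding 0 *[unfolded 0] three_term cubic_offdiag_def
      by (simp add: distrib_left distrib_right L_lin L_X_diag L_X_next L_X_far b_0
          L_X_swap[of "P (Suc (Suc 0))" "P (Suc 0)"] L_X_swap[of "P (Suc 0)" "P 0"]
          L_X_swap[of "P (Suc (Suc 0))" "P 0"])
         (simp add: hm[unfolded 0] algebra_simps power2_eq_square)
  next
    case (Suc k)
    have hk: "h (Suc k) = b (Suc k) * h k" by (simp flip: h_Suc)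
    show ?thesis unfolding Suc *[unfolded Suc] three_term cubic_offdiag_def
      by (simp add: distrib_left distrib_right L_lin L_X_diag L_X_next L_X_far
          L_X_swap[of "P (Suc (Suc (Suc k)))" "P (Suc (Suc k))"] L_X_swap[of "P (Suc (Suc k))" "P (Suc k)"]
          L_X_swap[of "P (Suc (Suc (Suc k)))" "P (Suc k)"] L_X_swap[of "P (Suc (Suc k))" "P k"]
          L_X_swap[of "P (Suc k)" "P k"])
         (simp add: hm[unfolded Suc] hk algebra_simps power2_eq_square)
  qed
qed

lemma L_double: "L (2 * p) = 2 * L p"
  by (simp only: mult_2 L_add)

lemma coeff_X_pderiv: "coeff (X * pderiv p) i = real i * coeff p i"
  by (cases i) (simp_all add: X_mult_conv coeff_pCons coeff_pderiv)

text \<open>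
  The string equation off the diagonal contains \<open>\<Sum>a\<^sub>k\<close> because \<open>x P\<^sub>n'\<close> agrees with
  \<open>n P\<^sub>n\<close>, up to terms of lower degree, minus the second coefficient of \<open>P\<^sub>n\<close> times \<open>P\<^sub>n\<^sub>-\<^sub>1\<close>.
\<close>
lemma subleading: "coeff (P (Suc n)) n = - (\<Sum>k\<le>n. a k)"
proof (induction n)
  case 0
  have "X * P 0 = P (Suc 0) + smult (a 0) (P 0)" using three_term[of 0] by (simp add: b_0)
  then have "coeff (X * P 0) 0 = coeff (P (Suc 0) + smult (a 0) (P 0)) 0" by simp
  then show ?case by (simp add: P_0 X_def)
next
  case (Suc n)
  have "coeff (X * P (Suc n)) (Suc n) =
        coeff (P (Suc (Suc n)) + smult (a (Suc n)) (P (Suc n)) + smult (b (Suc n)) (P n)) (Suc n)"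
    using three_term[of "Suc n"] by simp
  then show ?case using Suc by (simp add: coeff_P X_mult_conv)
qed

lemma L_deriv_diag: "L (X * pderiv (P n) * P n) = real n * h n"
proof -
  have "L ((X * pderiv (P n) - smult (real n) (P n)) * P n) = 0"
    by (rule orth_lower[of n]) (auto simp: coeff_X_pderiv coeff_P le_less)
  then show ?thesis by (simp add: left_diff_distrib L_lin h_def)
qed

lemma L_deriv_up: "L (X * pderiv (P m) * P (Suc m)) = 0"
  by (rule orth_lower[of "Suc m"]) (auto simp: coeff_X_pderiv coeff_P)

lemma L_deriv_down: "L (X * pderiv (P (Suc m)) * P m) = (\<Sum>k\<le>m. a k) * h m"
proof -
  define S where "S = (\<Sum>k\<le>m. a k)"
  have "L ((X * pderiv (P (Suc m)) - smult (real (Suc m)) (P (Suc m)) - smult S (P m)) * P m) = 0"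
  proof (rule orth_lower[of m])
    fix i assume "m \<le> i"
    then consider "i = m" | "i = Suc m" | "i > Suc m" by linarith
    then show "coeff (X * pderiv (P (Suc m)) - smult (real (Suc m)) (P (Suc m)) - smult S (P m)) i = 0"
      by cases (simp_all add: coeff_X_pderiv coeff_P subleading S_def algebra_simps)
  qed simp
  then show ?thesis by (simp add: left_diff_distrib L_lin h_def orth S_def)
qed

lemma pearson_expanded:
  "(lam + 1) * L p + t * L (X * p) - L (X * (X * (X * p))) + L (X * pderiv p) = 0"
proof -
  have "[:lam + 1, t, 0, -1:] * p = smult (lam + 1) p + smult t (X * p) - X * (X * (X * p))"
    by (simp add: X_mult_conv)
  then show ?thesis using pearson[of p] by (simp add: L_lin)
qed

text \<open>
  The Pearson identity applied to \<open>P\<^sub>n\<^sup>2\<close>; the derivative contributes \<open>2 n\<close> because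
  \<open>x P\<^sub>n' - n P\<^sub>n\<close> has lower degree than \<open>P\<^sub>n\<close>.
\<close>
lemma string_diag:
  "cubic_diag a b n - t * a n = 2 * real n + lam + 1"
proof -
  have "L (X * pderiv (P n * P n)) = 2 * real n * h n"
  proof -
    have "X * pderiv (P n * P n) = 2 * (X * pderiv (P n) * P n)"
      by (simp add: pderiv_mult algebra_simps)
    then show ?thesis by (simp only: L_double L_deriv_diag)
  qed
  then have "((lam + 1) + t * a n - cubic_diag a b n + 2 * real n) * h n = 0"
    using pearson_expanded[of "P n * P n"] unfolding L_X3_diag L_X_diag h_def[symmetric]
    by (simp add: algebra_simps)
  then show ?thesis using h_pos[of n] by simp
qed

text \<open>
  The Pearson identity applied to \<open>P\<^sub>m P\<^sub>m\<^sub>+\<^sub>1\<close>, where orthogonality removes \<open>\<lambda> + 1\<close>.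
\<close>
lemma string_offdiag:
  "(\<Sum>k\<le>m. a k) + t * b (Suc m) = b (Suc m) * cubic_offdiag a b m"
proof -
  have "L (X * pderiv (P m * P (Suc m))) = (\<Sum>k\<le>m. a k) * h m"
  proof -
    have "X * pderiv (P m * P (Suc m)) = X * pderiv (P m) * P (Suc m) + X * pderiv (P (Suc m)) * P m"
      by (simp only: pderiv_mult distrib_left ac_simps)
    then show ?thesis by (simp only: L_add L_deriv_up L_deriv_down)
  qed
  moreover have "L (P m * P (Suc m)) = 0" by (simp add: orth)
  moreover have "L (X * (P m * P (Suc m))) = b (Suc m) * h m" by (simp only: L_X_next h_Suc)
  ultimately have "((\<Sum>k\<le>m. a k) + t * b (Suc m) - b (Suc m) * cubic_offdiag a b m) * h m = 0"
    using pearson_expanded[of "P m * P (Suc m)"] L_X3_next[of m] by algebra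
  then show ?thesis using h_pos[of m] by simp
qed

lemma prod_b: "(\<Prod>k<n. b (Suc k)) * h 0 = h n"
proof (induction n)
  case (Suc n)
  have "(\<Prod>k<Suc n. b (Suc k)) * h 0 = b (Suc n) * ((\<Prod>k<n. b (Suc k)) * h 0)"
    by (simp add: mult.assoc mult.commute)
  then show ?case by (simp only: Suc h_Suc)
qed simp

text \<open>
  A monic polynomial of degree \<open>n\<close> is \<open>P\<^sub>n\<close> plus a polynomial orthogonal to \<open>P\<^sub>n\<close>. With
  \<open>prod_b\<close> this turns every moment estimate into an upper bound on \<open>b\<^sub>1 ... b\<^sub>n\<close>.
\<close>
lemma h_minimal:
  assumes "degree q = n" "lead_coeff q = 1"
  shows "h n \<le> L (q * q)"
proof -
  define r where "r = q - P n"
  have "coeff r i = 0" if "i \<ge> n" for i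
    using that assms coeff_P(1)[of n] coeff_P(2)[of n i] by (cases "i = n") (auto simp: r_def coeff_eq_0)
  then have "L (r * P n) = 0" using orth_lower[of n r n] by simp
  moreover have "q * q = P n * P n + 2 * (r * P n) + r * r"
    by (simp add: r_def algebra_simps)
  ultimately have "L (q * q) = h n + L (r * r)" by (simp add: L_lin L_double h_def)
  moreover have "L (r * r) \<ge> 0"
    by (cases "r = 0") (auto intro!: less_imp_le[OF L_pos])
  ultimately show ?thesis by simp
qed

text \<open>
  Since \<open>a\<^sub>0\<close> is the mean, this is the decomposition of the second moment about \<open>r\<close> into the
  variance \<open>h\<^sub>1\<close> and the squared bias, with the variance dropped.
\<close>
lemma mean_deviation: "(a 0 - r)\<^sup>2 * h 0 \<le> L ([:- r, 1:] * [:- r, 1:])"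
proof -
  have "P (Suc 0) = X * P 0 - smult (a 0) (P 0)"
    using three_term[of 0] by (simp add: b_0)
  then have "P (Suc 0) = [:- a 0, 1:]" by (simp add: P_0 X_def)
  then have "[:- r, 1:] = P (Suc 0) + smult (a 0 - r) (P 0)"
    by (simp add: P_0)
  from this have "L ([:- r, 1:] * [:- r, 1:]) = h (Suc 0) + (a 0 - r)\<^sup>2 * h 0"
    by (simp only: distrib_left distrib_right L_lin mult_smult_left mult_smult_right)
       (simp add: orth h_def power2_eq_square)
  then show ?thesis using h_pos[of "Suc 0"] by simp
qed

end

section \<open>The generalised Airy weight as a functional\<close>

definition weight_integral :: "real \<Rightarrow> real \<Rightarrow> real poly \<Rightarrow> real" where
  "weight_integral t lam p = (LINT x:{0<..}|lborel. poly p x * gen_airy_weight t lam x)"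

text \<open>
  Applied with \<open>t + 1\<close> in place of \<open>t\<close>, this dominates the weight by a multiple of the Gamma
  integrand \<open>x\<^sup>\<lambda> exp(-x)\<close>.
\<close>
lemma airy_exponent_bound:
  fixes x t :: real assumes "x \<ge> 0"
  shows "- (x ^ 3 / 3) + t * x \<le> \<bar>t\<bar> * sqrt (3 * \<bar>t\<bar>)"
proof (cases "x \<le> sqrt (3 * \<bar>t\<bar>)")
  case True
  have "t * x \<le> \<bar>t\<bar> * sqrt (3 * \<bar>t\<bar>)" using True assms by (intro mult_mono) auto
  moreover have "x ^ 3 \<ge> 0" using assms by simp
  ultimately show ?thesis by linarith
next
  case False
  then have "sqrt (3 * \<bar>t\<bar>) ^ 2 \<le> x ^ 2" by (intro power_mono) auto
  then have "3 * \<bar>t\<bar> \<le> x ^ 2" by simp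
  then have "3 * \<bar>t\<bar> * x \<le> x ^ 2 * x" using assms by (intro mult_right_mono) auto
  then have "\<bar>t\<bar> * x \<le> x ^ 3 / 3" by (simp add: power2_eq_square power3_eq_cube)
  moreover have "t * x \<le> \<bar>t\<bar> * x" using assms by (intro mult_right_mono) auto
  ultimately have "- (x ^ 3 / 3) + t * x \<le> 0" by linarith
  also have "0 \<le> \<bar>t\<bar> * sqrt (3 * \<bar>t\<bar>)" by simp
  finally show ?thesis .
qed

lemma set_integrable_powr_exp:
  fixes s :: real assumes "s > -1"
  shows "set_integrable lborel {0<..} (\<lambda>x. x powr s * exp (- x))"
proof -
  have "(\<lambda>x. x powr s / exp x) absolutely_integrable_on {0..}"
    using Gamma_integral_real[of "s + 1"] assms
    by (intro nonnegative_absolutely_integrable_1) (auto simp: has_integral_integrable_integral)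
  then have "(\<lambda>x. x powr s / exp x) absolutely_integrable_on {0<..}"
    by (rule set_integrable_subset) auto
  then show ?thesis
    unfolding set_integrable_def
    by (subst (asm) integrable_completion) (auto simp: exp_minus field_simps)
qed

lemma set_integrable_gen_airy_weight:
  assumes "lam > -1"
  shows "set_integrable lborel {0<..} (\<lambda>x. poly p x * gen_airy_weight t lam x)"
proof -
  have mono: "set_integrable lborel {0<..} (\<lambda>x. x ^ k * gen_airy_weight t lam x)" for k
  proof (rule set_integrable_bound)
    define C where "C = exp (\<bar>t + 1\<bar> * sqrt (3 * \<bar>t + 1\<bar>))"
    show "set_integrable lborel {0<..} (\<lambda>x. C * (x powr (lam + real k) * exp (- x)))"
      using assms by (intro set_integrable_mult_right set_integrable_powr_exp) auto
    show "set_borel_measurable lborel {0<..} (\<lambda>x. x ^ k * gen_airy_weight t lam x)"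
      unfolding gen_airy_weight_def set_borel_measurable_def by measurable
    show "AE x in lborel. x \<in> {0<..} \<longrightarrow> norm (x ^ k * gen_airy_weight t lam x)
            \<le> norm (C * (x powr (lam + real k) * exp (- x)))"
    proof (intro AE_I2 impI)
      fix x :: real assume "x \<in> {0<..}"
      then have x: "x > 0" by simp
      have "exp (- (x ^ 3 / 3) + (t + 1) * x) \<le> C"
        unfolding C_def exp_le_cancel_iff using x by (intro airy_exponent_bound) simp
      then have "exp (- (x ^ 3 / 3) + (t + 1) * x) * exp (- x) \<le> C * exp (- x)"
        by (intro mult_right_mono) auto
      then have "exp (- (x ^ 3 / 3) + t * x) \<le> C * exp (- x)"
        by (simp add: algebra_simps flip: exp_add)
      then have "x powr (lam + real k) * exp (- (x ^ 3 / 3) + t * x) \<le> x powr (lam + real k) * (C * exp (- x))"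
        by (intro mult_left_mono) auto
      moreover have "x ^ k * gen_airy_weight t lam x = x powr (lam + real k) * exp (- (x ^ 3 / 3) + t * x)"
        using x by (simp add: gen_airy_weight_def powr_add powr_realpow)
      ultimately show "norm (x ^ k * gen_airy_weight t lam x) \<le> norm (C * (x powr (lam + real k) * exp (- x)))"
        using x by (simp add: C_def mult_ac)
    qed
  qed
  have "set_integrable lborel {0<..} (\<lambda>x. \<Sum>k\<le>degree p. coeff p k * (x ^ k * gen_airy_weight t lam x))"
    using mono unfolding set_integrable_def scaleR_sum_right
    by (intro Bochner_Integration.integrable_sum) (simp add: mult.left_commute[of "indicator _ _"])
  then show ?thesis
    by (simp add: poly_altdef sum_distrib_right mult.assoc)
qed

lemma weight_integral_add:
  "lam > -1 \<Longrightarrow> weight_integral t lam (p + q) = weight_integral t lam p + weight_integral t lam q"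
  unfolding weight_integral_def
  by (simp add: distrib_right set_integral_add set_integrable_gen_airy_weight)

lemma weight_integral_smult: "weight_integral t lam (smult c p) = c * weight_integral t lam p"
  unfolding weight_integral_def by (simp add: mult.assoc)

lemma weight_integral_pos:
  assumes "lam > -1" "q \<noteq> 0" "\<And>x. x > 0 \<Longrightarrow> poly q x \<ge> 0"
  shows "weight_integral t lam q > 0"
proof -
  let ?f = "\<lambda>x. indicator {0<..} x *\<^sub>R (poly q x * gen_airy_weight t lam x)"
  have int: "integrable lborel ?f"
    using set_integrable_gen_airy_weight[OF assms(1)] unfolding set_integrable_def .
  have nonneg: "?f x \<ge> 0" for x
    using assms(3)[of x] by (auto simp: gen_airy_weight_def indicator_def)
  have "weight_integral t lam q \<noteq> 0"
  proof
    assume "weight_integral t lam q = 0"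
    then have "integral\<^sup>L lborel ?f = 0" by (simp add: weight_integral_def set_lebesgue_integral_def)
    then have "AE x in lborel. ?f x = 0"
      using int nonneg by (subst (asm) integral_nonneg_eq_0_iff_AE) auto
    moreover have "finite {x. poly q x = 0}" by (rule poly_roots_finite[OF assms(2)])
    then have "AE x in lborel. x \<notin> {x. poly q x = 0}"
      by (intro AE_not_in) (auto intro: finite_imp_null_set_lborel)
    ultimately have "AE x in lborel. x \<notin> {0<..<(1::real)}"
      by eventually_elim (auto simp: gen_airy_weight_def)
    then have "emeasure lborel {0<..<(1::real)} = 0"
      by (subst (asm) AE_iff_measurable[where N = "{0<..<(1::real)}"]) auto
    then show False by simp
  qed
  moreover have "weight_integral t lam q \<ge> 0"
    unfolding weight_integral_def set_lebesgue_integral_def using nonneg by (intro integral_nonneg_AE) auto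
  ultimately show ?thesis by simp
qed

text \<open>
  The integrand is the derivative of \<open>p x\<^sup>\<lambda>\<^sup>+\<^sup>1 exp(-x\<^sup>3/3 + t x)\<close>, which vanishes at both ends of
  the half-line, at 0 because \<open>\<lambda> > -1\<close>.
\<close>
lemma weight_integral_pearson:
  assumes "lam > -1"
  shows "weight_integral t lam ([:lam + 1, t, 0, -1:] * p + X * pderiv p) = 0"
proof -
  define E where "E = (\<lambda>x::real. exp (- (x ^ 3 / 3) + t * x))"
  define G where "G = (\<lambda>x. poly p x * (x powr (lam + 1) * E x))"
  define q where "q = [:lam + 1, t, 0, -1:] * p + X * pderiv p"
  define g where "g = (\<lambda>x. poly q x * gen_airy_weight t lam x)"
  have deriv: "(G has_vector_derivative g x) (at x)" if "x > 0" for x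
  proof -
    have pw: "((\<lambda>z. z powr (lam + 1)) has_real_derivative (lam + 1) * x powr lam) (at x)"
      using has_real_derivative_powr[OF that, of "lam + 1"] by simp
    have ex: "(E has_real_derivative (t - x ^ 2) * E x) (at x)"
      unfolding E_def by (rule derivative_eq_intros refl | simp)+
    have "(G has_real_derivative poly (pderiv p) x * (x powr (lam + 1) * E x) +
            ((lam + 1) * x powr lam * E x + (t - x ^ 2) * E x * x powr (lam + 1)) * poly p x) (at x)"
      unfolding G_def by (intro DERIV_mult poly_DERIV pw ex)
    also have "poly (pderiv p) x * (x powr (lam + 1) * E x) +
            ((lam + 1) * x powr lam * E x + (t - x ^ 2) * E x * x powr (lam + 1)) * poly p x = g x"
      using that by (simp add: g_def q_def X_def gen_airy_weight_def E_def powr_add algebra_simps power2_eq_square)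
    finally have "(G has_real_derivative g x) (at x)" .
    then show ?thesis by (simp add: has_real_derivative_iff_has_vector_derivative)
  qed
  have lim0: "(G \<longlongrightarrow> 0) (at_right 0)"
  proof -
    have "((\<lambda>x. x powr (lam + 1)) \<longlongrightarrow> 0) (at_right (0::real))" using assms by real_asymp
    moreover have "(E \<longlongrightarrow> E 0) (at_right 0)"
      unfolding E_def by (intro tendsto_intros) auto
    moreover have "(poly p \<longlongrightarrow> poly p 0) (at_right 0)" by (intro tendsto_intros)
    ultimately have "(G \<longlongrightarrow> poly p 0 * (0 * E 0)) (at_right 0)"
      unfolding G_def by (intro tendsto_mult)
    then show ?thesis by simp
  qed
  have liminf: "(G \<longlongrightarrow> 0) at_top"
  proof -
    have "((\<lambda>x. coeff p k * (x powr (lam + 1 + real k) * E x)) \<longlongrightarrow> coeff p k * 0) at_top" for k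
      unfolding E_def by (intro tendsto_mult_left) real_asymp
    then have "((\<lambda>x. \<Sum>k\<le>degree p. coeff p k * (x powr (lam + 1 + real k) * E x)) \<longlongrightarrow> (\<Sum>k\<le>degree p. coeff p k * 0)) at_top"
      by (intro tendsto_sum)
    moreover have "\<forall>\<^sub>F x in at_top. (\<Sum>k\<le>degree p. coeff p k * (x powr (lam + 1 + real k) * E x)) = G x"
      using eventually_gt_at_top[of 0]
      by eventually_elim (simp add: G_def poly_altdef sum_distrib_right powr_add powr_realpow mult_ac sum_distrib_left)
    ultimately show ?thesis by (subst (asm) tendsto_cong) auto
  qed
  have "(LBINT x=0..\<infinity>. g x) = 0 - 0"
  proof (rule interval_integral_FTC_integrable)
    show "set_integrable lborel (einterval 0 \<infinity>) g"
      using set_integrable_gen_airy_weight[OF assms, of q t] by (simp add: g_def einterval_def greaterThan_def zero_ereal_def)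
    show "((G \<circ> real_of_ereal) \<longlongrightarrow> 0) (at_right 0)"
      using lim0 unfolding zero_ereal_def by (simp add: ereal_tendsto_simps)
    show "((G \<circ> real_of_ereal) \<longlongrightarrow> 0) (at_left \<infinity>)"
      using liminf by (simp add: ereal_tendsto_simps)
    show "isCont g x" if "0 < ereal x" for x
      using that unfolding g_def gen_airy_weight_def by (intro continuous_intros) auto
  qed (use deriv in auto)
  then show ?thesis
    by (simp add: interval_lebesgue_integral_def einterval_def weight_integral_def g_def q_def
        greaterThan_def zero_ereal_def)
qed

section \<open>Concentration at the saddle point\<close>

lemma gaussian_integral:
  fixes c m :: real assumes "c > 0"
  shows "integrable lborel (\<lambda>x. exp (- c * (x - m)\<^sup>2))"
    and "(LINT x|lborel. exp (- c * (x - m)\<^sup>2)) = sqrt (pi / c)"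
proof -
  define s where "s = 1 / sqrt (2 * c)"
  have s2: "s\<^sup>2 = 1 / (2 * c)" and s0: "s > 0"
    using assms by (simp_all add: s_def power_divide)
  have eq: "exp (- c * (x - m)\<^sup>2) = sqrt (pi / c) * normal_density m s x" for x
    using assms by (simp add: normal_density_def s2 real_sqrt_divide mult.commute)
  show "integrable lborel (\<lambda>x. exp (- c * (x - m)\<^sup>2))"
    unfolding eq using s0 by simp
  show "(LINT x|lborel. exp (- c * (x - m)\<^sup>2)) = sqrt (pi / c)"
    unfolding eq using s0 by simp
qed

text \<open>
  For \<open>t = r\<^sup>2\<close> the exponent \<open>-x\<^sup>3/3 + t x\<close> has its maximum on the half-line at \<open>x = r\<close>, and it
  is an exact square times a linear factor below that maximum, so no Taylor remainder occurs.
\<close>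
lemma weight_at_saddle:
  "gen_airy_weight (r\<^sup>2) lam x = exp (2 * r ^ 3 / 3) * (x powr lam * exp (- ((x - r)\<^sup>2 * (x + 2 * r) / 3)))"
proof -
  have "- (x ^ 3 / 3) + r\<^sup>2 * x = 2 * r ^ 3 / 3 + - ((x - r)\<^sup>2 * (x + 2 * r) / 3)"
    by (simp add: field_simps power2_eq_square power3_eq_cube)
  then show ?thesis unfolding gen_airy_weight_def by (simp only: exp_add mult_ac)
qed

text \<open>
  Away from 0 the factor \<open>(x/r)\<^sup>\<lambda>\<close> costs only a small part of the Gaussian decay, whatever the
  sign of \<open>\<lambda>\<close>.
\<close>
lemma powr_le_gaussian:
  fixes u lam :: real
  assumes "u \<ge> 1 / 2"
  shows "u powr lam \<le> (2 powr (- lam) + exp (3 / 2 * lam\<^sup>2)) * exp ((u - 1)\<^sup>2 / 6)"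
proof (cases "lam \<ge> 0")
  case True
  have "0 \<le> (3 * lam - (u - 1))\<^sup>2" by simp
  also have "\<dots> = 9 * lam\<^sup>2 + (u - 1)\<^sup>2 - 6 * (lam * (u - 1))"
    by (simp only: power2_diff[of "3 * lam"]) (simp add: power_mult_distrib)
  finally have *: "lam * (u - 1) \<le> 3 / 2 * lam\<^sup>2 + (u - 1)\<^sup>2 / 6"
    by linarith
  have "ln u \<le> u - 1" using assms by (intro ln_le_minus_one) auto
  then have "lam * ln u \<le> lam * (u - 1)" using True by (rule mult_left_mono)
  then have "u powr lam \<le> exp (3 / 2 * lam\<^sup>2 + (u - 1)\<^sup>2 / 6)"
    using * assms by (simp add: powr_def)
  also have "\<dots> \<le> (2 powr (- lam) + exp (3 / 2 * lam\<^sup>2)) * exp ((u - 1)\<^sup>2 / 6)"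
    unfolding exp_add by (intro mult_right_mono) auto
  finally show ?thesis .
next
  case False
  have "u powr lam \<le> (1 / 2) powr lam" using assms False by (intro powr_mono2') auto
  also have "\<dots> = 2 powr (- lam) * 1" by (simp add: powr_divide powr_minus_divide)
  also have "\<dots> \<le> (2 powr (- lam) + exp (3 / 2 * lam\<^sup>2)) * exp ((u - 1)\<^sup>2 / 6)"
    by (intro mult_mono) auto
  finally show ?thesis .
qed

lemma power_le_fact_exp: "x \<ge> 0 \<Longrightarrow> x ^ n \<le> fact n * exp (x::real)"
proof -
  assume x: "x \<ge> 0"
  have "(\<Sum>k<Suc n. x ^ k /\<^sub>R fact k) \<le> exp x"
    unfolding exp_def using x by (intro sum_le_suminf summable_exp_generic) auto
  moreover have "x ^ n /\<^sub>R fact n \<le> (\<Sum>k<Suc n. x ^ k /\<^sub>R fact k)"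
    using x by (intro member_le_sum) auto
  ultimately show ?thesis by (simp add: field_simps)
qed

text \<open>
  The first term of the bound covers \<open>x > r/2\<close>: of the decay \<open>exp(-2 r (x-r)\<^sup>2/3)\<close> one quarter pays
  for the polynomial, producing \<open>r\<^sup>-\<^sup>n\<close>, one quarter for \<open>(x/r)\<^sup>\<lambda>\<close>, and half is left to be
  integrated. The second term covers \<open>x \<le> r/2\<close>, where \<open>x\<^sup>\<lambda>\<close> may be singular but the exponent lies
  at least \<open>r\<^sup>3/6\<close> below its maximum.
\<close>
lemma shifted_weight_upper:
  fixes r x lam :: real
  assumes "r \<ge> 1" "x > 0"
  shows "(x - r) ^ (2 * n) * (x powr lam * exp (- ((x - r)\<^sup>2 * (x + 2 * r) / 3)))
     \<le> 6 ^ n * fact n * (2 powr (- lam) + exp (3 / 2 * lam\<^sup>2)) * r powr (lam - real n)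
          * exp (- (r / 3) * (x - r)\<^sup>2)
       + r powr (2 * real n) * exp (r / 2 - r ^ 3 / 6) * (x powr lam * exp (- x))"
proof (cases "x \<le> r / 2")
  case True
  have "\<bar>x - r\<bar> ^ (2 * n) \<le> r ^ (2 * n)" using assms True by (intro power_mono) auto
  then have 1: "(x - r) ^ (2 * n) \<le> r powr (2 * real n)"
    using assms powr_realpow[of r "2 * n"] by (simp add: power_even_abs)
  have "(r / 2)\<^sup>2 * (2 * r) \<le> (x - r)\<^sup>2 * (x + 2 * r)"
  proof (rule mult_mono)
    have "(r / 2)\<^sup>2 \<le> (r - x)\<^sup>2" using assms True by (intro power_mono) auto
    then show "(r / 2)\<^sup>2 \<le> (x - r)\<^sup>2" by (simp add: power2_commute)
  qed (use assms in auto)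
  then have "- ((x - r)\<^sup>2 * (x + 2 * r) / 3) \<le> - (r ^ 3 / 6)"
    by (simp add: power2_eq_square power3_eq_cube)
  also have "\<dots> \<le> (r / 2 - r ^ 3 / 6) + (- x)" using True by simp
  finally have 2: "exp (- ((x - r)\<^sup>2 * (x + 2 * r) / 3)) \<le> exp (r / 2 - r ^ 3 / 6) * exp (- x)"
    by (simp only: exp_le_cancel_iff flip: exp_add)
  have "(x - r) ^ (2 * n) * (x powr lam * exp (- ((x - r)\<^sup>2 * (x + 2 * r) / 3)))
      \<le> r powr (2 * real n) * (x powr lam * (exp (r / 2 - r ^ 3 / 6) * exp (- x)))"
    using 1 2 by (intro mult_mono mult_left_mono) auto
  also have "\<dots> = r powr (2 * real n) * exp (r / 2 - r ^ 3 / 6) * (x powr lam * exp (- x))"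
    by simp
  also have "\<dots> \<le> 6 ^ n * fact n * (2 powr (- lam) + exp (3 / 2 * lam\<^sup>2)) * r powr (lam - real n)
          * exp (- (r / 3) * (x - r)\<^sup>2)
       + r powr (2 * real n) * exp (r / 2 - r ^ 3 / 6) * (x powr lam * exp (- x))"
    by simp
  finally show ?thesis .
next
  case False
  define q where "q = (x - r)\<^sup>2"
  define K where "K = 2 powr (- lam) + exp (3 / 2 * lam\<^sup>2)"
  have q0: "q \<ge> 0" and K0: "K > 0" by (auto simp: q_def K_def intro: add_pos_pos)
  have "(r * q / 6) ^ n \<le> fact n * exp (r * q / 6)"
    using assms q0 by (intro power_le_fact_exp) auto
  then have "r ^ n * q ^ n \<le> 6 ^ n * (fact n * exp (r * q / 6))"
    by (simp add: power_divide power_mult_distrib field_simps)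
  then have 1: "(x - r) ^ (2 * n) \<le> 6 ^ n * fact n * r powr (- real n) * exp (r * q / 6)"
    unfolding power_mult q_def[symmetric] using assms by (simp add: powr_minus powr_realpow field_simps)
  have "(x / r) powr lam \<le> K * exp ((x / r - 1)\<^sup>2 / 6)"
    unfolding K_def using False assms by (intro powr_le_gaussian) (simp add: field_simps)
  moreover have "(x / r - 1)\<^sup>2 \<le> r * q"
  proof -
    have "(x / r - 1)\<^sup>2 = q / r\<^sup>2" using assms by (simp add: q_def field_simps power2_eq_square)
    also have "\<dots> \<le> q / 1" using assms q0 by (intro divide_left_mono) auto
    also have "\<dots> \<le> r * q" using assms q0 mult_right_mono[of 1 r q] by simp
    finally show ?thesis .
  qed
  then have "K * exp ((x / r - 1)\<^sup>2 / 6) \<le> K * exp (r * q / 6)" using K0 by simp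
  ultimately have "(x / r) powr lam \<le> K * exp (r * q / 6)" by linarith
  then have 2: "x powr lam \<le> r powr lam * (K * exp (r * q / 6))"
    using assms by (simp add: powr_divide field_simps)
  have "q * (2 * r) \<le> q * (x + 2 * r)" using assms q0 by (intro mult_left_mono) auto
  then have 3: "exp (- (q * (x + 2 * r) / 3)) \<le> exp (- (2 / 3 * (r * q)))" by simp
  have "(x - r) ^ (2 * n) * (x powr lam * exp (- (q * (x + 2 * r) / 3)))
     \<le> (6 ^ n * fact n * r powr (- real n) * exp (r * q / 6))
        * ((r powr lam * (K * exp (r * q / 6))) * exp (- (2 / 3 * (r * q))))"
    using 1 2 3 K0 by (intro mult_mono) auto
  also have "\<dots> = 6 ^ n * fact n * K * (r powr lam * r powr (- real n)) *
       (exp (r * q / 6) * exp (r * q / 6) * exp (- (2 / 3 * (r * q))))" by simp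
  also have "exp (r * q / 6) * exp (r * q / 6) * exp (- (2 / 3 * (r * q))) = exp (- (r / 3) * q)"
    by (simp flip: exp_add)
  also have "r powr lam * r powr (- real n) = r powr (lam - real n)" by (simp flip: powr_add)
  also have "6 ^ n * fact n * K * r powr (lam - real n) * exp (- (r / 3) * q) \<le>
     6 ^ n * fact n * K * r powr (lam - real n) * exp (- (r / 3) * q)
       + r powr (2 * real n) * exp (r / 2 - r ^ 3 / 6) * (x powr lam * exp (- x))"
    by simp
  finally show ?thesis by (simp add: q_def K_def)
qed

text \<open>
  The mass on \<open>[r, r + r\<^sup>-\<^sup>1\<^sup>/\<^sup>2]\<close>, whose length is comparable to the width of the peak,
  already has the order of the whole mass.
\<close>
lemma weight_integral_lower:
  fixes r lam :: real
  assumes "lam > -1" "r \<ge> 1"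
  shows "exp (2 * r ^ 3 / 3) * (min 1 (2 powr lam) * exp (- (4 / 3)) * r powr (lam - 1 / 2))
           \<le> weight_integral (r\<^sup>2) lam 1"
proof -
  define c where "c = exp (2 * r ^ 3 / 3) * (min 1 (2 powr lam) * r powr lam * exp (- (4 / 3)))"
  define d where "d = r powr (- 1 / 2)"
  have d: "0 < d" "d \<le> 1" "d ^ 2 * r = 1"
  proof -
    have "r powr (-1/2) \<le> r powr 0" using assms by (intro powr_mono) auto
    then show "d \<le> 1" using assms by (simp add: d_def)
    have "d ^ 2 = r powr (- 1)" using assms by (simp add: d_def power2_eq_square flip: powr_add)
    then show "d ^ 2 * r = 1" using assms by (simp add: powr_minus)
  qed (use assms in \<open>auto simp: d_def\<close>)
  have le: "c * indicator {r..r + d} x \<le> indicator {0<..} x *\<^sub>R (poly 1 x * gen_airy_weight (r\<^sup>2) lam x)" for x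
  proof (cases "x \<in> {r..r + d}")
    case True
    then have x: "r \<le> x" "x \<le> r + d" by auto
    have "min 1 (2 powr lam) * r powr lam \<le> x powr lam"
    proof (cases "lam \<ge> 0")
      case True
      have "min 1 (2 powr lam) * r powr lam \<le> 1 * r powr lam" by (intro mult_right_mono) auto
      also have "\<dots> \<le> x powr lam" using x assms True by (simp add: powr_mono2)
      finally show ?thesis .
    next
      case False
      have "min 1 (2 powr lam) * r powr lam \<le> 2 powr lam * r powr lam" by (intro mult_right_mono) auto
      also have "\<dots> = (2 * r) powr lam" using assms by (simp add: powr_mult)
      also have "\<dots> \<le> x powr lam" using x assms d False by (intro powr_mono2') auto
      finally show ?thesis .
    qed
    moreover have "exp (- (4 / 3)) \<le> exp (- ((x - r)\<^sup>2 * (x + 2 * r) / 3))"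
    proof -
      have "(x - r)\<^sup>2 \<le> d\<^sup>2" using x by (intro power_mono) auto
      moreover have "x + 2 * r \<le> 4 * r" using x d assms by simp
      ultimately have "(x - r)\<^sup>2 * (x + 2 * r) \<le> d\<^sup>2 * (4 * r)" using x assms by (intro mult_mono) auto
      then show ?thesis using d by simp
    qed
    ultimately have "min 1 (2 powr lam) * r powr lam * exp (- (4 / 3))
        \<le> x powr lam * exp (- ((x - r)\<^sup>2 * (x + 2 * r) / 3))"
      by (intro mult_mono) auto
    then show ?thesis using x assms by (simp add: c_def weight_at_saddle)
  qed (auto simp: indicator_def gen_airy_weight_def)
  have "(LINT x|lborel. c * indicator {r..r + d} x) \<le> weight_integral (r\<^sup>2) lam 1"
    unfolding weight_integral_def set_lebesgue_integral_def
  proof (rule integral_mono)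
    show "integrable lborel (\<lambda>x. indicator {0<..} x *\<^sub>R (poly 1 x * gen_airy_weight (r\<^sup>2) lam x))"
      using set_integrable_gen_airy_weight[OF assms(1)] unfolding set_integrable_def .
  qed (use le in \<open>auto intro!: integrable_mult_right integrable_real_indicator simp: d(1) less_imp_le\<close>)
  moreover have "(LINT x|lborel. c * indicator {r..r + d} x) = c * d" using d by simp
  moreover have "r powr lam * d = r powr (lam - 1 / 2)" by (simp add: d_def flip: powr_add)
  then have "c * d = exp (2 * r ^ 3 / 3) * (min 1 (2 powr lam) * exp (- (4 / 3)) * r powr (lam - 1 / 2))"
    by (simp add: c_def mult_ac)
  ultimately show ?thesis by simp
qed

text \<open>
  The common factor \<open>exp(2 r\<^sup>3/3)\<close> of both bounds cancels, the Gaussian integral supplies the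
  \<open>r\<^sup>-\<^sup>1\<^sup>/\<^sup>2\<close> of the lower bound, and the contribution from near 0 is exponentially small.
\<close>
lemma weight_integral_concentration:
  fixes lam :: real
  assumes "lam > -1"
  obtains C where "C > 0" "\<forall>\<^sub>F r in at_top.
     weight_integral (r\<^sup>2) lam ([:-r, 1:] ^ n * [:-r, 1:] ^ n) \<le> C * r powr (- real n) * weight_integral (r\<^sup>2) lam 1"
proof -
  define G where "G = (LINT x:{0<..}|lborel. x powr lam * exp (- x))"
  define K where "K = 6 ^ n * fact n * (2 powr (- lam) + exp (3 / 2 * lam\<^sup>2))"
  define c where "c = min 1 (2 powr lam) * exp (- (4 / 3) :: real)"
  have c: "c > 0" by (simp add: c_def)
  have K: "K > 0" by (auto simp: K_def intro!: mult_pos_pos add_pos_pos)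
  have G: "G \<ge> 0" unfolding G_def set_lebesgue_integral_def by (intro integral_nonneg_AE) auto
  have upper: "weight_integral (r\<^sup>2) lam ([:-r, 1:] ^ n * [:-r, 1:] ^ n) \<le>
      exp (2 * r ^ 3 / 3) * (K * r powr (lam - real n) * sqrt (3 * pi / r)
        + r powr (2 * real n) * exp (r / 2 - r ^ 3 / 6) * G)" if r: "r \<ge> 1" for r
  proof -
    let ?g = "\<lambda>x. exp (2 * r ^ 3 / 3) * (K * r powr (lam - real n) * exp (- (r / 3) * (x - r)\<^sup>2)
        + r powr (2 * real n) * exp (r / 2 - r ^ 3 / 6) * (indicator {0<..} x *\<^sub>R (x powr lam * exp (- x))))"
    have i1: "integrable lborel (\<lambda>x. exp (- (r / 3) * (x - r)\<^sup>2))"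
      and i2: "(LINT x|lborel. exp (- (r / 3) * (x - r)\<^sup>2)) = sqrt (3 * pi / r)"
      using gaussian_integral[of "r / 3" r] r by (simp_all add: mult.commute)
    have i3: "integrable lborel (\<lambda>x. indicator {0<..} x *\<^sub>R (x powr lam * exp (- x)))"
      using set_integrable_powr_exp[OF assms] unfolding set_integrable_def .
    have "weight_integral (r\<^sup>2) lam ([:-r, 1:] ^ n * [:-r, 1:] ^ n) \<le> (LINT x|lborel. ?g x)"
      unfolding weight_integral_def set_lebesgue_integral_def
    proof (rule integral_mono)
      show "integrable lborel (\<lambda>x. indicator {0<..} x *\<^sub>R
              (poly ([:-r, 1:] ^ n * [:-r, 1:] ^ n) x * gen_airy_weight (r\<^sup>2) lam x))"
        using set_integrable_gen_airy_weight[OF assms] unfolding set_integrable_def .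
      show "integrable lborel ?g"
        by (intro integrable_mult_right Bochner_Integration.integrable_add i1 i3)
      show "indicator {0<..} x *\<^sub>R (poly ([:-r, 1:] ^ n * [:-r, 1:] ^ n) x * gen_airy_weight (r\<^sup>2) lam x) \<le> ?g x" for x
      proof (cases "x > 0")
        case True
        have "poly ([:-r, 1:] ^ n * [:-r, 1:] ^ n) x = (x - r) ^ (2 * n)"
          by (simp add: mult_2 power_add)
        then show ?thesis
          using shifted_weight_upper[OF r True, of n lam] True
          by (simp add: weight_at_saddle K_def mult.left_commute[of _ "exp (2 * r ^ 3 / 3)"])
      next
        case False
        then show ?thesis using K by simp
      qed
    qed
    also have "(LINT x|lborel. ?g x) = exp (2 * r ^ 3 / 3) * (K * r powr (lam - real n) * sqrt (3 * pi / r)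
        + r powr (2 * real n) * exp (r / 2 - r ^ 3 / 6) * G)"
      unfolding G_def set_lebesgue_integral_def i2[symmetric] using i1 i3
      by (simp only: integral_mult_right_zero integral_mult_right Bochner_Integration.integral_add integrable_mult_right)
    finally show ?thesis .
  qed
  have small: "\<forall>\<^sub>F r::real in at_top. r powr (2 * real n) * exp (r / 2 - r ^ 3 / 6) \<le> r powr (lam - real n - 1 / 2)"
    by real_asymp
  show ?thesis
  proof (rule that[of "(K * sqrt (3 * pi) + G) / c"])
    show "(K * sqrt (3 * pi) + G) / c > 0"
      using c K G by (intro divide_pos_pos add_pos_nonneg mult_pos_pos) auto
    show "\<forall>\<^sub>F r in at_top.
       weight_integral (r\<^sup>2) lam ([:-r, 1:] ^ n * [:-r, 1:] ^ n)
         \<le> (K * sqrt (3 * pi) + G) / c * r powr (- real n) * weight_integral (r\<^sup>2) lam 1"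
      using small eventually_ge_at_top[of 1]
    proof eventually_elim
      case (elim r)
      have s: "r powr (lam - real n) * sqrt (3 * pi / r) = sqrt (3 * pi) * r powr (lam - real n - 1 / 2)"
        using elim by (simp add: real_sqrt_divide powr_diff powr_half_sqrt)
      have "weight_integral (r\<^sup>2) lam ([:-r, 1:] ^ n * [:-r, 1:] ^ n) \<le>
         exp (2 * r ^ 3 / 3) * (K * r powr (lam - real n) * sqrt (3 * pi / r)
        + r powr (2 * real n) * exp (r / 2 - r ^ 3 / 6) * G)" using elim by (intro upper) auto
      also have "\<dots> \<le> exp (2 * r ^ 3 / 3) * (K * sqrt (3 * pi) * r powr (lam - real n - 1 / 2)
          + r powr (lam - real n - 1 / 2) * G)"
        using elim G s by (intro mult_left_mono add_mono mult_right_mono) (auto simp: mult.assoc)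
      also have "\<dots> = (K * sqrt (3 * pi) + G) / c * r powr (- real n) *
           (exp (2 * r ^ 3 / 3) * (c * r powr (lam - 1 / 2)))"
      proof -
        have "r powr (lam - real n - 1 / 2) = r powr (- real n) * r powr (lam - 1 / 2)"
          by (simp add: algebra_simps flip: powr_add)
        then show ?thesis using c by (simp add: field_simps)
      qed
      also have "\<dots> \<le> (K * sqrt (3 * pi) + G) / c * r powr (- real n) * weight_integral (r\<^sup>2) lam 1"
        using weight_integral_lower[OF assms, of r] elim c K G
        by (intro mult_left_mono) (auto simp: c_def)
      finally show ?case .
    qed
  qed
qed

section \<open>Calculus of first-order expansions\<close>

text \<open>
  In the bootstrap every quantity is a rational expression in finitely many others, with
  remainders measured against one small positive parameter \<open>e\<close>. Boundedness (\<open>bd\<close>) and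
  \<open>f = c + O(e)\<close> (\<open>approx f c\<close>) are closed under the operations that occur; an
  expansion to second order is a statement \<open>approx\<close> about the quotient \<open>(f - c) / e\<close>.
\<close>
locale asymptotic_scale =
  fixes F :: "real filter" and e :: "real \<Rightarrow> real"
  assumes e_lim: "(e \<longlongrightarrow> 0) F" and e_pos: "\<forall>\<^sub>F t in F. e t > 0"
begin

text \<open>
  Eventual boundedness along \<open>F\<close>, which for reciprocals such as \<open>e / g\<close> also expresses a lower
  bound.
\<close>
definition bd :: "(real \<Rightarrow> real) \<Rightarrow> bool" where "bd f \<longleftrightarrow> f \<in> O[F](\<lambda>_. 1)"

definition approx :: "(real \<Rightarrow> real) \<Rightarrow> real \<Rightarrow> bool" where
  "approx f c \<longleftrightarrow> (\<exists>h. bd h \<and> (\<forall>\<^sub>F t in F. f t = c + e t * h t))"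

lemma bdI: "\<forall>\<^sub>F t in F. \<bar>f t\<bar> \<le> C \<Longrightarrow> bd f"
  unfolding bd_def by (rule bigoI[of _ C]) auto

lemma bdE:
  assumes "bd f"
  obtains C where "C > 0" "\<forall>\<^sub>F t in F. \<bar>f t\<bar> \<le> C"
  using assms unfolding bd_def by (elim landau_o.bigE) auto

lemma bd_const [simp]: "bd (\<lambda>_. c)" by (simp add: bd_def)

lemma bd_add: "bd f \<Longrightarrow> bd g \<Longrightarrow> bd (\<lambda>t. f t + g t)"
  unfolding bd_def by (rule sum_in_bigo)

lemma bd_diff: "bd f \<Longrightarrow> bd g \<Longrightarrow> bd (\<lambda>t. f t - g t)"
  unfolding bd_def by (rule sum_in_bigo)

lemma bd_mult: "bd f \<Longrightarrow> bd g \<Longrightarrow> bd (\<lambda>t. f t * g t)"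
  unfolding bd_def using landau_o.big.mult[of f F "\<lambda>_. 1" g "\<lambda>_. 1"] by simp

lemma bd_power: "bd f \<Longrightarrow> bd (\<lambda>t. f t ^ k)"
  by (induction k) (simp_all add: bd_mult)

lemma bd_sum: "(\<And>k. k \<in> I \<Longrightarrow> bd (f k)) \<Longrightarrow> bd (\<lambda>t. \<Sum>k\<in>I. f k t)"
  by (induction I rule: infinite_finite_induct) (auto intro: bd_add)

lemma bd_prod: "(\<And>k. k \<in> I \<Longrightarrow> bd (f k)) \<Longrightarrow> bd (\<lambda>t. \<Prod>k\<in>I. f k t)"
  by (induction I rule: infinite_finite_induct) (auto intro: bd_mult)

lemma bd_cong: "\<forall>\<^sub>F t in F. f t = g t \<Longrightarrow> bd f \<longleftrightarrow> bd g"
  unfolding bd_def by (rule landau_o.big.in_cong)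

lemma bd_tendsto: "(f \<longlongrightarrow> c) F \<Longrightarrow> bd f"
proof -
  assume "(f \<longlongrightarrow> c) F"
  then have "((\<lambda>t. \<bar>f t\<bar>) \<longlongrightarrow> \<bar>c\<bar>) F" by (rule tendsto_rabs)
  then have "\<forall>\<^sub>F t in F. \<bar>f t\<bar> < \<bar>c\<bar> + 1" by (rule order_tendstoD) simp
  then show ?thesis by (intro bdI[of _ "\<bar>c\<bar> + 1"]) (auto elim: eventually_mono)
qed

lemma bd_e: "bd e" by (rule bd_tendsto[OF e_lim])

lemmas bd_intros = bd_const bd_add bd_diff bd_mult bd_power bd_sum bd_prod bd_e

lemma approxI: "bd h \<Longrightarrow> \<forall>\<^sub>F t in F. f t = c + e t * h t \<Longrightarrow> approx f c"
  unfolding approx_def by blast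

lemma approxE:
  assumes "approx f c"
  obtains h where "bd h" "\<forall>\<^sub>F t in F. f t = c + e t * h t"
  using assms unfolding approx_def by blast

lemma approx_tendsto: "approx f c \<Longrightarrow> (f \<longlongrightarrow> c) F"
proof -
  assume "approx f c"
  then obtain h where h: "bd h" "\<forall>\<^sub>F t in F. f t = c + e t * h t" by (rule approxE)
  from h(1) obtain C where C: "C > 0" "\<forall>\<^sub>F t in F. \<bar>h t\<bar> \<le> C" by (rule bdE)
  have "((\<lambda>t. e t * h t) \<longlongrightarrow> 0) F"
  proof (rule Lim_null_comparison)
    show "\<forall>\<^sub>F t in F. norm (e t * h t) \<le> e t * C"
      using C(2) e_pos by eventually_elim (simp add: abs_mult)
    show "((\<lambda>t. e t * C) \<longlongrightarrow> 0) F" using tendsto_mult_left_zero[OF e_lim] .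
  qed
  then have "((\<lambda>t. c + e t * h t) \<longlongrightarrow> c + 0) F" by (intro tendsto_add tendsto_const)
  moreover have "\<forall>\<^sub>F t in F. c + e t * h t = f t" using h(2) by eventually_elim simp
  ultimately show ?thesis by (simp add: tendsto_cong)
qed

lemma approx_bd: "approx f c \<Longrightarrow> bd f"
  by (rule bd_tendsto[OF approx_tendsto])

lemma approx_const: "approx (\<lambda>_. c) c"
  by (rule approxI[of "\<lambda>_. 0"]) auto

lemma approx_add:
  assumes "approx f c" "approx g d" shows "approx (\<lambda>t. f t + g t) (c + d)"
proof -
  obtain h k where *: "bd h" "\<forall>\<^sub>F t in F. f t = c + e t * h t" "bd k" "\<forall>\<^sub>F t in F. g t = d + e t * k t"
    using assms unfolding approx_def by blast
  show ?thesis
  proof (rule approxI[of "\<lambda>t. h t + k t"])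
    show "\<forall>\<^sub>F t in F. f t + g t = c + d + e t * (h t + k t)"
      using *(2,4) by eventually_elim (simp add: algebra_simps)
  qed (intro bd_intros *)
qed

lemma approx_mult:
  assumes "approx f c" "approx g d" shows "approx (\<lambda>t. f t * g t) (c * d)"
proof -
  obtain h k where *: "bd h" "\<forall>\<^sub>F t in F. f t = c + e t * h t" "bd k" "\<forall>\<^sub>F t in F. g t = d + e t * k t"
    using assms unfolding approx_def by blast
  show ?thesis
  proof (rule approxI[of "\<lambda>t. c * k t + d * h t + e t * (h t * k t)"])
    show "\<forall>\<^sub>F t in F. f t * g t = c * d + e t * (c * k t + d * h t + e t * (h t * k t))"
      using *(2,4) by eventually_elim (simp add: algebra_simps)
  qed (intro bd_intros *)
qed

lemma approx_diff:
  assumes "approx f c" "approx g d" shows "approx (\<lambda>t. f t - g t) (c - d)"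
  using approx_add[OF assms(1) approx_mult[OF approx_const[of "-1"] assms(2)]] by simp

lemma approx_power: "approx f c \<Longrightarrow> approx (\<lambda>t. f t ^ k) (c ^ k)"
  by (induction k) (auto intro: approx_const approx_mult)

lemma approx_sum: "(\<And>k. k \<in> I \<Longrightarrow> approx (f k) (c k)) \<Longrightarrow> approx (\<lambda>t. \<Sum>k\<in>I. f k t) (\<Sum>k\<in>I. c k)"
  by (induction I rule: infinite_finite_induct) (auto intro: approx_add approx_const)

lemma approx_divide:
  assumes f: "approx f c" and g: "approx g d" and d: "d \<noteq> 0"
  shows "approx (\<lambda>t. f t / g t) (c / d)"
proof -
  obtain h k where *: "bd h" "\<forall>\<^sub>F t in F. f t = c + e t * h t" "bd k" "\<forall>\<^sub>F t in F. g t = d + e t * k t"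
    using f g unfolding approx_def by blast
  have gd: "(g \<longlongrightarrow> d) F" by (rule approx_tendsto[OF g])
  have nz: "\<forall>\<^sub>F t in F. g t \<noteq> 0" by (rule tendsto_imp_eventually_ne[OF gd d])
  have inv: "bd (\<lambda>t. inverse (g t))" by (rule bd_tendsto[OF tendsto_inverse[OF gd d]])
  show ?thesis
  proof (rule approxI[of "\<lambda>t. (h t - c / d * k t) * inverse (g t)"])
    show "\<forall>\<^sub>F t in F. f t / g t = c / d + e t * ((h t - c / d * k t) * inverse (g t))"
      using *(2,4) nz
    proof eventually_elim
      case (elim t)
      have "c + e t * h t = c / d * (d + e t * k t) + e t * (h t - c / d * k t)"
        using d by (simp add: field_simps)
      then have "f t = c / d * g t + e t * (h t - c / d * k t)" using elim by simp
      then have "f t / g t = (c / d * g t + e t * (h t - c / d * k t)) / g t" by simp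
      also have "\<dots> = c / d + e t * ((h t - c / d * k t) * inverse (g t))"
        using elim(3) by (simp add: add_divide_distrib) (simp add: divide_inverse mult.assoc)
      finally show ?case .
    qed
  qed (intro bd_intros * inv)
qed

lemma approx_small: "bd h \<Longrightarrow> approx (\<lambda>t. e t * h t) 0"
  by (rule approxI[of h]) auto

lemma approx_cong:
  assumes "approx f c" "\<forall>\<^sub>F t in F. g t = f t" shows "approx g c"
proof -
  obtain h where h: "bd h" "\<forall>\<^sub>F t in F. f t = c + e t * h t" using assms(1) by (rule approxE)
  show ?thesis by (rule approxI[OF h(1)]) (use h(2) assms(2) in eventually_elim, simp)
qed

lemma approx_bigo: "approx f c \<Longrightarrow> (\<lambda>t. f t - c) \<in> O[F](e)"
proof -
  assume "approx f c"
  then obtain h where h: "bd h" "\<forall>\<^sub>F t in F. f t = c + e t * h t" by (rule approxE)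
  then have "(\<lambda>t. e t * h t) \<in> O[F](\<lambda>t. e t * 1)"
    unfolding bd_def by (intro landau_o.big.mult) auto
  moreover have "\<forall>\<^sub>F t in F. e t * h t = f t - c" using h(2) by eventually_elim simp
  ultimately show ?thesis by (simp add: landau_o.big.in_cong)
qed

lemmas approx_intros = approx_const approx_add approx_mult approx_diff approx_power approx_sum

lemma bd_cubic_diag:
  "(\<And>k. bd (a k)) \<Longrightarrow> (\<And>k. bd (b k)) \<Longrightarrow> bd (\<lambda>t. cubic_diag (\<lambda>k. a k t) (\<lambda>k. b k t) n)"
  unfolding cubic_diag_def by (intro bd_intros)

lemma bd_cubic_offdiag:
  "(\<And>k. bd (a k)) \<Longrightarrow> (\<And>k. bd (b k)) \<Longrightarrow> bd (\<lambda>t. cubic_offdiag (\<lambda>k. a k t) (\<lambda>k. b k t) n)"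
  unfolding cubic_offdiag_def by (intro bd_intros)

lemma approx_cubic_diag:
  "(\<And>k. approx (a k) (a' k)) \<Longrightarrow> (\<And>k. approx (b k) (b' k)) \<Longrightarrow>
     approx (\<lambda>t. cubic_diag (\<lambda>k. a k t) (\<lambda>k. b k t) n) (cubic_diag a' b' n)"
  unfolding cubic_diag_def by (intro approx_intros)

lemma approx_cubic_offdiag:
  "(\<And>k. approx (a k) (a' k)) \<Longrightarrow> (\<And>k. approx (b k) (b' k)) \<Longrightarrow>
     approx (\<lambda>t. cubic_offdiag (\<lambda>k. a k t) (\<lambda>k. b k t) n) (cubic_offdiag a' b' n)"
  unfolding cubic_offdiag_def by (intro approx_intros)

end

section \<open>Bootstrapping in the Laguerre regime\<close>

text \<open>
  The rescaled string equations for \<open>t \<rightarrow> -\<infinity>\<close>. At \<open>e = 0\<close> they are those of the Laguerre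
  polynomials, with solutions \<open>c\<close> and \<open>D\<close> below.
\<close>
locale laguerre_scaling = asymptotic_scale +
  fixes A B :: "nat \<Rightarrow> real \<Rightarrow> real" and lam :: real
  assumes A_pos: "\<forall>\<^sub>F t in F. A n t > 0"
    and B_nonneg: "\<forall>\<^sub>F t in F. B n t \<ge> 0"
    and B_0: "\<forall>\<^sub>F t in F. B 0 t = 0"
    and eq1: "\<forall>\<^sub>F t in F. A n t + e t * cubic_diag (\<lambda>k. A k t) (\<lambda>k. B k t) n = 2 * real n + lam + 1"
    and eq2: "\<forall>\<^sub>F t in F. (\<Sum>k\<le>m. A k t) =
       B (Suc m) t + e t * (B (Suc m) t * cubic_offdiag (\<lambda>k. A k t) (\<lambda>k. B k t) m)"
begin

definition c :: "nat \<Rightarrow> real" where "c n = 2 * real n + lam + 1"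

definition D :: "nat \<Rightarrow> real" where "D n = real n * (real n + lam)"

lemma sum_c: "(\<Sum>k\<le>m. c k) = D (Suc m)"
  by (induction m) (simp_all add: c_def D_def algebra_simps)

lemma cubic_diag_nonneg:
  "\<lbrakk>\<And>k. k \<in> {n - 1, n, Suc n} \<Longrightarrow> a k > 0; \<And>k. k \<in> {n, Suc n} \<Longrightarrow> b k \<ge> 0\<rbrakk> \<Longrightarrow> cubic_diag a b n \<ge> (0::real)"
  unfolding cubic_diag_def by (intro add_nonneg_nonneg mult_nonneg_nonneg) (auto simp: less_imp_le)

text \<open>
  The cubic term is nonnegative, so \<open>A\<^sub>n\<close> cannot exceed the right-hand side of its equation; the
  same argument bounds \<open>B\<^sub>n\<close> by the sum of the \<open>A\<^sub>k\<close>.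
\<close>
lemma bd_A: "bd (A n)"
proof (rule bdI[of _ "c n"])
  show "\<forall>\<^sub>F t in F. \<bar>A n t\<bar> \<le> c n"
    using eq1[of n] A_pos[of n] A_pos[of "n - 1"] A_pos[of "Suc n"] B_nonneg[of n] B_nonneg[of "Suc n"] e_pos
  proof eventually_elim
    case (elim t)
    have "cubic_diag (\<lambda>k. A k t) (\<lambda>k. B k t) n \<ge> 0"
      using elim by (intro cubic_diag_nonneg) auto
    then have "e t * cubic_diag (\<lambda>k. A k t) (\<lambda>k. B k t) n \<ge> 0" using elim by simp
    then show ?case using elim by (simp add: c_def)
  qed
qed

lemma bd_B: "bd (B n)"
proof (cases n)
  case 0
  show ?thesis by (rule bdI[of _ 0]) (use B_0 in \<open>simp add: 0\<close>)
next
  case (Suc m)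
  obtain C where C: "\<forall>\<^sub>F t in F. \<bar>\<Sum>k\<le>m. A k t\<bar> \<le> C"
    using bdE[OF bd_sum[of "{..m}" A]] bd_A by blast
  show ?thesis
  proof (rule bdI[of _ C])
    show "\<forall>\<^sub>F t in F. \<bar>B n t\<bar> \<le> C"
      using eq2[of m] A_pos[of m] A_pos[of "Suc m"] B_nonneg[of m] B_nonneg[of "Suc m"]
        B_nonneg[of "Suc (Suc m)"] e_pos C
    proof eventually_elim
      case (elim t)
      have "cubic_offdiag (\<lambda>k. A k t) (\<lambda>k. B k t) m \<ge> 0"
        unfolding cubic_offdiag_def using elim by (intro add_nonneg_nonneg) auto
      then have "e t * (B (Suc m) t * cubic_offdiag (\<lambda>k. A k t) (\<lambda>k. B k t) m) \<ge> 0" using elim by simp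
      then show ?case using elim by (simp add: Suc)
    qed
  qed
qed

lemma approx_A: "approx (A n) (c n)"
proof (rule approxI[of "\<lambda>t. - 1 * cubic_diag (\<lambda>k. A k t) (\<lambda>k. B k t) n"])
  show "\<forall>\<^sub>F t in F. A n t = c n + e t * (- 1 * cubic_diag (\<lambda>k. A k t) (\<lambda>k. B k t) n)"
    using eq1[of n] by eventually_elim (simp add: c_def algebra_simps)
qed (intro bd_mult bd_const bd_cubic_diag bd_A bd_B)

lemma approx_B: "approx (B n) (D n)"
proof (cases n)
  case 0
  show ?thesis by (rule approx_cong[OF approx_const]) (use B_0 in \<open>simp add: 0 D_def\<close>)
next
  case (Suc m)
  show ?thesis unfolding Suc
  proof (rule approx_cong)
    have "approx (\<lambda>t. (\<Sum>k\<le>m. A k t) - e t * (B (Suc m) t * cubic_offdiag (\<lambda>k. A k t) (\<lambda>k. B k t) m))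
            ((\<Sum>k\<le>m. c k) - 0)"
      by (intro approx_diff approx_sum approx_A approx_small bd_mult bd_B bd_cubic_offdiag bd_A)
    then show "approx (\<lambda>t. (\<Sum>k\<le>m. A k t) - e t * (B (Suc m) t * cubic_offdiag (\<lambda>k. A k t) (\<lambda>k. B k t) m))
            (D (Suc m))" by (simp add: sum_c)
    show "\<forall>\<^sub>F t in F. B (Suc m) t =
        (\<Sum>k\<le>m. A k t) - e t * (B (Suc m) t * cubic_offdiag (\<lambda>k. A k t) (\<lambda>k. B k t) m)"
      using eq2[of m] by eventually_elim simp
  qed
qed

lemma A_second_order: "(\<lambda>t. (A n t - c n) / e t + cubic_diag c D n) \<in> O[F](e)"
proof -
  have "approx (\<lambda>t. (A n t - c n) / e t) (- 1 * cubic_diag c D n)"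
  proof (rule approx_cong)
    show "approx (\<lambda>t. - 1 * cubic_diag (\<lambda>k. A k t) (\<lambda>k. B k t) n) (- 1 * cubic_diag c D n)"
      by (intro approx_mult approx_const approx_cubic_diag approx_A approx_B)
    show "\<forall>\<^sub>F t in F. (A n t - c n) / e t = - 1 * cubic_diag (\<lambda>k. A k t) (\<lambda>k. B k t) n"
      using eq1[of n] e_pos by eventually_elim (simp add: c_def field_simps)
  qed
  from approx_bigo[OF this] show ?thesis by simp
qed

text \<open>
  \<open>A\<^sub>k\<close> occurs linearly in the second equation, so its first-order correction
  \<open>- cubic_diag c D k\<close> enters \<open>B\<close> as a sum.
\<close>
lemma B_second_order:
  "(\<lambda>t. (B (Suc m) t - D (Suc m)) / e t
      + ((\<Sum>k\<le>m. cubic_diag c D k) + D (Suc m) * cubic_offdiag c D m)) \<in> O[F](e)"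
proof -
  have "approx (\<lambda>t. (B (Suc m) t - D (Suc m)) / e t)
     ((\<Sum>k\<le>m. - 1 * cubic_diag c D k) - D (Suc m) * cubic_offdiag c D m)"
  proof (rule approx_cong)
    show "approx (\<lambda>t. (\<Sum>k\<le>m. - 1 * cubic_diag (\<lambda>k. A k t) (\<lambda>k. B k t) k)
        - B (Suc m) t * cubic_offdiag (\<lambda>k. A k t) (\<lambda>k. B k t) m)
     ((\<Sum>k\<le>m. - 1 * cubic_diag c D k) - D (Suc m) * cubic_offdiag c D m)"
      by (intro approx_diff approx_sum approx_mult approx_const approx_cubic_diag approx_cubic_offdiag approx_A approx_B)
    have "\<forall>\<^sub>F t in F. \<forall>k\<in>{..m}. A k t + e t * cubic_diag (\<lambda>k. A k t) (\<lambda>k. B k t) k = c k"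
      using eq1 by (intro eventually_ball_finite) (auto simp: c_def)
    then show "\<forall>\<^sub>F t in F. (B (Suc m) t - D (Suc m)) / e t =
        (\<Sum>k\<le>m. - 1 * cubic_diag (\<lambda>k. A k t) (\<lambda>k. B k t) k)
        - B (Suc m) t * cubic_offdiag (\<lambda>k. A k t) (\<lambda>k. B k t) m"
      using eq2[of m] e_pos
    proof eventually_elim
      case (elim t)
      let ?K = "\<lambda>k. cubic_diag (\<lambda>k. A k t) (\<lambda>k. B k t) k"
      have "(\<Sum>k\<le>m. A k t) + e t * (\<Sum>k\<le>m. ?K k) = D (Suc m)"
        using elim(1) by (simp add: sum_distrib_left flip: sum_c sum.distrib)
      then show ?case using elim(2,3) by (simp add: sum_negf field_simps)
    qed
  qed
  from approx_bigo[OF this] show ?thesis by (simp add: sum_negf algebra_simps)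
qed

lemma cubic_diag_laguerre:
  "cubic_diag c D n = (2 * real n + lam + 1)
     * (10 * real n ^ 2 + 10 * real n * lam + lam ^ 2 + 10 * real n + 5 * lam + 6)"
  by (cases n) (simp_all add: cubic_diag_def c_def D_def algebra_simps power2_eq_square power3_eq_cube)

lemma second_coeff_laguerre:
  "(\<Sum>k\<le>m. cubic_diag c D k) + D (Suc m) * cubic_offdiag c D m =
     4 * real (Suc m) * (real (Suc m) + lam) * (5 * real (Suc m) ^ 2 + 5 * real (Suc m) * lam + lam ^ 2 + 1)"
proof -
  have "(\<Sum>k\<le>m. cubic_diag c D k) =
     real (Suc m) * (real (Suc m) + lam) * (5 * real (Suc m) ^ 2 + 5 * real (Suc m) * lam + lam ^ 2 + 1)"
    by (induction m)
       (simp_all add: cubic_diag_laguerre algebra_simps power2_eq_square power3_eq_cube)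
  then show ?thesis
    by (simp add: cubic_offdiag_def c_def D_def algebra_simps power2_eq_square power3_eq_cube)
qed

end

section \<open>Bootstrapping in the Hermite regime\<close>

text \<open>
  The rescaled string equations for \<open>t \<rightarrow> \<infinity>\<close>, together with the two consequences of the
  concentration of the weight at the saddle point.
\<close>
locale hermite_scaling = asymptotic_scale +
  fixes y g :: "nat \<Rightarrow> real \<Rightarrow> real" and lam :: real
  assumes y_pos: "\<forall>\<^sub>F t in F. y n t > 0"
    and g_pos: "\<forall>\<^sub>F t in F. g (Suc m) t > 0"
    and g_0: "\<forall>\<^sub>F t in F. g 0 t = 0"
    and eq1: "\<forall>\<^sub>F t in F. cubic_diag (\<lambda>k. y k t) (\<lambda>k. g k t) n - y n t = e t * (2 * real n + lam + 1)"
    and eq2: "\<forall>\<^sub>F t in F. e t * (\<Sum>k\<le>m. y k t) + g (Suc m) t =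
        g (Suc m) t * cubic_offdiag (\<lambda>k. y k t) (\<lambda>k. g k t) m"
    and y_0: "(y 0 \<longlongrightarrow> 1) F"
    and prod_g: "bd (\<lambda>t. \<Prod>k<n. g (Suc k) t / e t)"
begin

lemma g_nonneg: "\<forall>\<^sub>F t in F. g n t \<ge> 0"
proof (cases n)
  case 0
  then show ?thesis using g_0 by (auto elim: eventually_mono)
next
  case (Suc m)
  then show ?thesis using g_pos[of m] by (auto elim: eventually_mono)
qed

text \<open>
  All terms of the first equation except \<open>-y\<^sub>n\<close> are nonnegative, so \<open>y\<^sub>n\<^sup>3 \<le> y\<^sub>n + O(e)\<close>. In the
  same way the second equation gives \<open>g\<^sub>n\<^sup>2 \<le> g\<^sub>n + O(e)\<close>.
\<close>
lemma bd_y: "bd (y n)"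
proof (rule bdI)
  define C where "C = \<bar>2 * real n + lam + 1\<bar>"
  have e1: "\<forall>\<^sub>F t in F. e t < 1" by (rule order_tendstoD(2)[OF e_lim]) simp
  show "\<forall>\<^sub>F t in F. \<bar>y n t\<bar> \<le> 1 + C"
    using eq1[of n] y_pos[of n] y_pos[of "n - 1"] y_pos[of "Suc n"] g_nonneg[of n] g_nonneg[of "Suc n"] e_pos e1
  proof eventually_elim
    case (elim t)
    have "g n t * (2 * y n t + y (n - 1) t) + g (Suc n) t * (2 * y n t + y (Suc n) t) \<ge> 0"
      using elim by (intro add_nonneg_nonneg mult_nonneg_nonneg) auto
    moreover have "e t * (2 * real n + lam + 1) \<le> e t * C"
      unfolding C_def using elim by (intro mult_left_mono) auto
    moreover have "e t * C \<le> 1 * C"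
      using elim by (intro mult_right_mono) (auto simp: C_def)
    ultimately have *: "y n t ^ 3 \<le> y n t + C" using elim(1) by (simp add: cubic_diag_def)
    have "y n t \<le> 1 + C"
    proof (rule ccontr)
      assume "\<not> y n t \<le> 1 + C"
      then have gt: "y n t - 1 > C" "y n t > 1" by (auto simp: C_def)
      have "y n t - 1 = (y n t - 1) * 1" by simp
      also have "\<dots> \<le> (y n t - 1) * (y n t * (y n t + 1))"
        using gt mult_mono[of 1 "y n t" 1 "y n t + 1"] by (intro mult_left_mono) auto
      also have "\<dots> = y n t ^ 3 - y n t" by (simp add: algebra_simps power3_eq_cube)
      finally show False using * gt by linarith
    qed
    then show ?case using elim(2) by simp
  qed
qed

lemma bd_g: "bd (g n)"
proof (cases n)
  case 0
  show ?thesis by (rule bdI[of _ 0]) (use g_0 in \<open>simp add: 0\<close>)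
next
  case (Suc m)
  have "bd (\<lambda>t. e t * (\<Sum>k\<le>m. y k t))" by (intro bd_intros bd_y)
  then obtain C where C: "C > 0" "\<forall>\<^sub>F t in F. \<bar>e t * (\<Sum>k\<le>m. y k t)\<bar> \<le> C" by (rule bdE)
  show ?thesis
  proof (rule bdI)
    show "\<forall>\<^sub>F t in F. \<bar>g n t\<bar> \<le> 1 + C"
      using eq2[of m] y_pos[of m] y_pos[of "Suc m"] g_nonneg[of m] g_nonneg[of "Suc (Suc m)"] g_pos[of m] C(2)
    proof eventually_elim
      case (elim t)
      have "g (Suc m) t \<le> cubic_offdiag (\<lambda>k. y k t) (\<lambda>k. g k t) m"
      proof -
        have "y (Suc m) t ^ 2 + y (Suc m) t * y m t + y m t ^ 2 + g (Suc (Suc m)) t + g m t \<ge> 0"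
          using elim by (intro add_nonneg_nonneg) auto
        then show ?thesis unfolding cubic_offdiag_def by linarith
      qed
      then have "g (Suc m) t * g (Suc m) t \<le> g (Suc m) t * cubic_offdiag (\<lambda>k. y k t) (\<lambda>k. g k t) m"
        using elim by (intro mult_left_mono) auto
      then have "g (Suc m) t * g (Suc m) t \<le> g (Suc m) t + C"
        using elim by linarith
      then have *: "g (Suc m) t * (g (Suc m) t - 1) \<le> C" by (simp add: algebra_simps)
      have "g (Suc m) t \<le> 1 + C"
      proof (rule ccontr)
        assume "\<not> g (Suc m) t \<le> 1 + C"
        then have "1 * (g (Suc m) t - 1) \<le> g (Suc m) t * (g (Suc m) t - 1)"
          using C(1) by (intro mult_right_mono) auto
        then show False using * \<open>\<not> g (Suc m) t \<le> 1 + C\<close> by simp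
      qed
      then show ?case using elim by (simp add: Suc)
    qed
  qed
qed

text \<open>
  A lower bound of order \<open>e\<close> for \<open>g\<^sub>m\<^sub>+\<^sub>1\<close>: the second equation bounds \<open>e \<Sum>y\<^sub>k\<close> by a multiple of
  \<open>g\<^sub>m\<^sub>+\<^sub>1\<close>, and the summand \<open>y\<^sub>0\<close> alone is close to 1.
\<close>
lemma bd_e_div_g: "bd (\<lambda>t. e t / g (Suc m) t)"
proof -
  have "bd (\<lambda>t. cubic_offdiag (\<lambda>k. y k t) (\<lambda>k. g k t) m)" by (intro bd_cubic_offdiag bd_y bd_g)
  then obtain C where C: "C > 0" "\<forall>\<^sub>F t in F. \<bar>cubic_offdiag (\<lambda>k. y k t) (\<lambda>k. g k t) m\<bar> \<le> C" by (rule bdE)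
  have half: "\<forall>\<^sub>F t in F. y 0 t > 1 / 2" by (rule order_tendstoD(1)[OF y_0]) simp
  have pos: "\<forall>\<^sub>F t in F. \<forall>k\<in>{..m}. y k t > 0" using y_pos by (intro eventually_ball_finite) auto
  show ?thesis
  proof (rule bdI)
    show "\<forall>\<^sub>F t in F. \<bar>e t / g (Suc m) t\<bar> \<le> 2 * C"
      using eq2[of m] g_pos[of m] C(2) half pos e_pos
    proof eventually_elim
      case (elim t)
      have "y 0 t \<le> (\<Sum>k\<le>m. y k t)" using elim(5) by (intro member_le_sum) (auto simp: less_imp_le)
      then have "1 / 2 \<le> (\<Sum>k\<le>m. y k t)" using elim(4) by linarith
      then have "e t * (1 / 2) \<le> e t * (\<Sum>k\<le>m. y k t)" using elim(6) by (intro mult_left_mono) auto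
      also have "\<dots> \<le> g (Suc m) t * cubic_offdiag (\<lambda>k. y k t) (\<lambda>k. g k t) m" using elim by linarith
      also have "\<dots> \<le> g (Suc m) t * C" using elim by (intro mult_left_mono) auto
      finally show ?case using elim by (simp add: field_simps)
    qed
  qed
qed

definition G :: "nat \<Rightarrow> real \<Rightarrow> real" where "G n t = g n t / e t"

lemma g_eq: "\<forall>\<^sub>F t in F. g n t = e t * G n t"
  using e_pos by eventually_elim (simp add: G_def)

text \<open>
  \<open>G\<^sub>m\<^sub>+\<^sub>1\<close> is the product \<open>G\<^sub>1 ... G\<^sub>m\<^sub>+\<^sub>1\<close>, bounded by assumption, times the inverses of
  \<open>G\<^sub>1, ..., G\<^sub>m\<close>, bounded by \<open>bd_e_div_g\<close>.
\<close>
lemma bd_G: "bd (G n)"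
proof (cases n)
  case 0
  show ?thesis by (rule bdI[of _ 0]) (use g_0 in \<open>auto simp: 0 G_def elim: eventually_mono\<close>)
next
  case (Suc m)
  have "bd (\<lambda>t. (\<Prod>k<Suc m. g (Suc k) t / e t) * (\<Prod>k<m. e t / g (Suc k) t))"
    by (intro bd_mult bd_prod prod_g bd_e_div_g)
  moreover have "\<forall>\<^sub>F t in F. (\<Prod>k<Suc m. g (Suc k) t / e t) * (\<Prod>k<m. e t / g (Suc k) t) = G n t"
  proof -
    have "\<forall>\<^sub>F t in F. \<forall>k\<in>{..<m}. g (Suc k) t > 0" using g_pos by (intro eventually_ball_finite) auto
    then show ?thesis using e_pos
    proof eventually_elim
      case (elim t)
      have "(\<Prod>k<m. g (Suc k) t / e t) * (\<Prod>k<m. e t / g (Suc k) t) = (\<Prod>k<m. 1)"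
        unfolding prod.distrib[symmetric]
      proof (rule prod.cong)
        fix k assume "k \<in> {..<m}"
        then have "g (Suc k) t > 0" using elim(1) by blast
        then show "g (Suc k) t / e t * (e t / g (Suc k) t) = 1" using elim(2) by simp
      qed simp
      then show ?case by (simp add: G_def Suc mult_ac)
    qed
  qed
  ultimately show ?thesis by (simp add: bd_cong)
qed

lemma approx_g: "approx (g n) 0"
  by (rule approx_cong[OF approx_small[OF bd_G] g_eq])

text \<open>
  The first equation with the cubic part written as \<open>y\<^sub>n (y\<^sub>n + 1) (y\<^sub>n - 1)\<close> and everything else
  divided by \<open>e\<close>.
\<close>
definition R :: "nat \<Rightarrow> real \<Rightarrow> real" where
  "R n t = (2 * real n + lam + 1) - G n t * (2 * y n t + y (n - 1) t) - G (Suc n) t * (2 * y n t + y (Suc n) t)"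

lemma bd_R: "bd (R n)"
  unfolding R_def by (intro bd_intros bd_G bd_y)

lemma y_factor: "\<forall>\<^sub>F t in F. y n t * (y n t + 1) * (y n t - 1) = e t * R n t"
  using eq1[of n] g_eq[of n] g_eq[of "Suc n"]
proof eventually_elim
  case (elim t)
  show ?case using elim(1) unfolding cubic_diag_def elim(2,3) R_def
    by (simp add: algebra_simps power3_eq_cube)
qed

text \<open>
  By \<open>y_factor\<close>, \<open>y\<^sub>n (y\<^sub>n + 1) (y\<^sub>n - 1) = O(e)\<close>; the root 0 is the only obstacle.
\<close>
lemma approx_y_if_bounded_below:
  assumes "d > 0" "\<forall>\<^sub>F t in F. y n t \<ge> d"
  shows "approx (y n) 1"
proof (rule approxI[of "\<lambda>t. R n t * (1 / (y n t * (y n t + 1)))"])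
  have "bd (\<lambda>t. 1 / (y n t * (y n t + 1)))"
  proof (rule bdI)
    show "\<forall>\<^sub>F t in F. \<bar>1 / (y n t * (y n t + 1))\<bar> \<le> 1 / d"
      using assms(2)
    proof eventually_elim
      case (elim t)
      have "d * 1 \<le> y n t * (y n t + 1)" using elim assms(1) by (intro mult_mono) auto
      then show ?case using assms(1) elim by (simp add: field_simps)
    qed
  qed
  then show "bd (\<lambda>t. R n t * (1 / (y n t * (y n t + 1))))" by (intro bd_mult bd_R)
  show "\<forall>\<^sub>F t in F. y n t = 1 + e t * (R n t * (1 / (y n t * (y n t + 1))))"
    using y_factor[of n] assms(2)
  proof eventually_elim
    case (elim t)
    then have "y n t * (y n t + 1) \<noteq> 0" using assms(1) by auto
    then have "y n t - 1 = e t * R n t / (y n t * (y n t + 1))"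
      using elim(1) by (simp add: eq_divide_eq mult_ac)
    then show ?case by simp
  qed
qed

text \<open>
  The root 0 is excluded inductively. Divided by \<open>g\<^sub>m\<^sub>+\<^sub>1\<close>, the second equation says that
  \<open>cubic_offdiag - 1 = \<Sum>y\<^sub>k / G\<^sub>m\<^sub>+\<^sub>1\<close>, which is bounded below by some \<open>\<eta> > 0\<close>. Since \<open>y\<^sub>m \<rightarrow> 1\<close> and
  the \<open>g\<^sub>k\<close> tend to 0, the left-hand side differs from \<open>y\<^sub>m\<^sub>+\<^sub>1 (y\<^sub>m\<^sub>+\<^sub>1 + y\<^sub>m)\<close> by \<open>o(1)\<close>, so
  \<open>y\<^sub>m\<^sub>+\<^sub>1\<close> stays away from 0.
\<close>
lemma approx_y: "approx (y n) 1"
proof (induction n)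
  case 0
  have "\<forall>\<^sub>F t in F. y 0 t > 1 / 2" by (rule order_tendstoD(1)[OF y_0]) simp
  then show ?case by (intro approx_y_if_bounded_below[of "1 / 2"]) (auto elim: eventually_mono)
next
  case (Suc m)
  obtain C where C: "C > 0" "\<forall>\<^sub>F t in F. \<bar>G (Suc m) t\<bar> \<le> C" using bdE[OF bd_G] by blast
  obtain Y where Y: "Y > 0" "\<forall>\<^sub>F t in F. \<bar>y (Suc m) t + y m t\<bar> \<le> Y"
    using bdE[OF bd_add[OF bd_y bd_y]] by blast
  define \<eta> where "\<eta> = 1 / (2 * C)"
  have \<eta>: "\<eta> > 0" using C by (simp add: \<eta>_def)
  have half: "\<forall>\<^sub>F t in F. y 0 t > 1 / 2" by (rule order_tendstoD(1)[OF y_0]) simp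
  have pos: "\<forall>\<^sub>F t in F. \<forall>k\<in>{..m}. y k t > 0" using y_pos by (intro eventually_ball_finite) auto
  have "approx (\<lambda>t. y m t ^ 2 + g (Suc (Suc m)) t + g (Suc m) t + g m t) (1 ^ 2 + 0 + 0 + 0)"
    by (intro approx_add approx_power Suc.IH approx_g)
  then have "((\<lambda>t. y m t ^ 2 + g (Suc (Suc m)) t + g (Suc m) t + g m t) \<longlongrightarrow> 1) F"
    using approx_tendsto by fastforce
  then have near: "\<forall>\<^sub>F t in F. y m t ^ 2 + g (Suc (Suc m)) t + g (Suc m) t + g m t < 1 + \<eta> / 2"
    by (rule order_tendstoD) (use \<eta> in simp)
  have "\<forall>\<^sub>F t in F. y (Suc m) t \<ge> \<eta> / (2 * Y)"
    using eq2[of m] C(2) Y(2) half pos near g_pos[of m] e_pos y_pos[of "Suc m"] g_eq[of "Suc m"]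
  proof eventually_elim
    case (elim t)
    define Q where "Q = cubic_offdiag (\<lambda>k. y k t) (\<lambda>k. g k t) m"
    have Gpos: "G (Suc m) t > 0" using elim(7,8) by (simp add: G_def)
    have "y 0 t \<le> (\<Sum>k\<le>m. y k t)" using elim(5) by (intro member_le_sum) (auto simp: less_imp_le)
    then have S: "1 / 2 \<le> (\<Sum>k\<le>m. y k t)" using elim(4) by linarith
    have "e t * (\<Sum>k\<le>m. y k t) = e t * (G (Suc m) t * (Q - 1))"
      using elim(1) unfolding Q_def[symmetric] elim(10) by (simp add: algebra_simps)
    then have SQ: "(\<Sum>k\<le>m. y k t) = G (Suc m) t * (Q - 1)" using elim(8) by simp
    then have "G (Suc m) t * (Q - 1) > 0" using S by linarith
    then have "Q - 1 > 0" using Gpos by (simp add: zero_less_mult_iff)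
    then have "G (Suc m) t * (Q - 1) \<le> C * (Q - 1)" using elim(2) by (intro mult_right_mono) auto
    then have "1 / 2 \<le> C * (Q - 1)" using S SQ by linarith
    then have "\<eta> \<le> Q - 1" using C(1) by (simp add: \<eta>_def field_simps)
    moreover have "Q = y (Suc m) t * (y (Suc m) t + y m t) + (y m t ^ 2 + g (Suc (Suc m)) t + g (Suc m) t + g m t)"
      by (simp add: Q_def cubic_offdiag_def algebra_simps power2_eq_square)
    ultimately have "\<eta> / 2 \<le> y (Suc m) t * (y (Suc m) t + y m t)" using elim(6) by linarith
    also have "\<dots> \<le> y (Suc m) t * Y" using elim by (intro mult_left_mono) auto
    finally show ?case using Y(1) by (simp add: field_simps)
  qed
  then show ?case using \<eta> Y(1) by (intro approx_y_if_bounded_below[of "\<eta> / (2 * Y)"]) auto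
qed

lemma G_offdiag:
  "\<forall>\<^sub>F t in F. (\<Sum>k\<le>m. y k t) = G (Suc m) t * (cubic_offdiag (\<lambda>k. y k t) (\<lambda>k. g k t) m - 1)"
  using eq2[of m] g_eq[of "Suc m"] e_pos
proof eventually_elim
  case (elim t)
  have "e t * (\<Sum>k\<le>m. y k t) = e t * (G (Suc m) t * (cubic_offdiag (\<lambda>k. y k t) (\<lambda>k. g k t) m - 1))"
    using elim(1) unfolding elim(2) by (simp add: algebra_simps)
  then show ?case using elim(3) by simp
qed

lemma approx_offdiag: "approx (\<lambda>t. cubic_offdiag (\<lambda>k. y k t) (\<lambda>k. g k t) m - 1) 2"
proof -
  have "approx (\<lambda>t. cubic_offdiag (\<lambda>k. y k t) (\<lambda>k. g k t) m - 1) (cubic_offdiag (\<lambda>_. 1) (\<lambda>_. 0) m - 1)"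
    by (intro approx_diff approx_cubic_offdiag approx_y approx_g approx_const)
  then show ?thesis by (simp add: cubic_offdiag_def)
qed

lemma approx_G: "approx (G n) (real n / 2)"
proof (cases n)
  case 0
  show ?thesis by (rule approx_cong[OF approx_const]) (use g_0 in \<open>auto simp: 0 G_def elim: eventually_mono\<close>)
next
  case (Suc m)
  let ?Q = "\<lambda>t. cubic_offdiag (\<lambda>k. y k t) (\<lambda>k. g k t) m - 1"
  have "approx (\<lambda>t. (\<Sum>k\<le>m. y k t) / ?Q t) ((\<Sum>k\<le>m. 1) / 2)"
    by (intro approx_divide approx_sum approx_y approx_offdiag) simp
  moreover have "\<forall>\<^sub>F t in F. G n t = (\<Sum>k\<le>m. y k t) / ?Q t"
  proof -
    have "\<forall>\<^sub>F t in F. ?Q t \<noteq> 0"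
      by (rule tendsto_imp_eventually_ne[OF approx_tendsto[OF approx_offdiag]]) simp
    then show ?thesis using G_offdiag[of m] by eventually_elim (simp add: Suc)
  qed
  ultimately have "approx (G n) ((\<Sum>k\<le>m. 1) / 2)" by (rule approx_cong)
  then show ?thesis by (simp add: Suc)
qed

definition dev :: "nat \<Rightarrow> real \<Rightarrow> real" where "dev n t = (y n t - 1) / e t"

lemma y_dev: "\<forall>\<^sub>F t in F. y n t = 1 + e t * dev n t"
  using e_pos by eventually_elim (simp add: dev_def)

lemma approx_dev: "approx (dev n) (- (2 * real n - 2 * lam + 1) / 4)"
proof (rule approx_cong)
  have R: "approx (R n) ((2 * real n + lam + 1) - real n / 2 * (2 * 1 + 1) - real (Suc n) / 2 * (2 * 1 + 1))"
    unfolding R_def by (intro approx_intros approx_G approx_y)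
  have "approx (\<lambda>t. R n t / (y n t * (y n t + 1)))
      (((2 * real n + lam + 1) - real n / 2 * (2 * 1 + 1) - real (Suc n) / 2 * (2 * 1 + 1)) / (1 * (1 + 1)))"
    by (intro approx_divide R approx_intros approx_y) auto
  moreover have "((2 * real n + lam + 1) - real n / 2 * (2 * 1 + 1) - real (Suc n) / 2 * (2 * 1 + 1)) / (1 * (1 + 1))
      = - (2 * real n - 2 * lam + 1) / 4" by (simp add: field_simps)
  ultimately show "approx (\<lambda>t. R n t / (y n t * (y n t + 1))) (- (2 * real n - 2 * lam + 1) / 4)" by (simp only:)
  show "\<forall>\<^sub>F t in F. dev n t = R n t / (y n t * (y n t + 1))"
    using y_factor[of n] y_pos[of n] e_pos
  proof eventually_elim
    case (elim t)
    then have "y n t * (y n t + 1) \<noteq> 0" by auto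
    then show ?case using elim by (simp add: dev_def divide_eq_eq eq_divide_eq mult_ac)
  qed
qed

lemma sum_first_order:
  "(\<Sum>k\<le>m. - (2 * real k - 2 * lam + 1) / 4) = - (real (Suc m) * (real (Suc m) - 2 * lam)) / 4"
  by (induction m) (simp_all add: field_simps)

text \<open>
  Writing \<open>cubic_offdiag - 1 = 2 + e W\<close> and \<open>\<Sum>y\<^sub>k = N + e \<Sum>dev\<^sub>k\<close> with \<open>N = m + 1\<close> in
  \<open>G_offdiag\<close>, the terms of order 1 cancel against \<open>N/2\<close> and the limit of \<open>W\<close> follows from the first-order results.
\<close>
lemma approx_G_second:
  "approx (\<lambda>t. (G (Suc m) t - real (Suc m) / 2) / e t) (real (Suc m) * (real (Suc m) - 2 * lam) / 4)"
proof (rule approx_cong)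
  define N where "N = real (Suc m)"
  define a :: "nat \<Rightarrow> real" where "a = (\<lambda>k. - (2 * real k - 2 * lam + 1) / 4)"
  define W where "W = (\<lambda>t. 3 * dev (Suc m) t + 3 * dev m t + G (Suc (Suc m)) t + G (Suc m) t + G m t
      + e t * (dev (Suc m) t ^ 2 + dev (Suc m) t * dev m t + dev m t ^ 2))"
  let ?Q = "\<lambda>t. cubic_offdiag (\<lambda>k. y k t) (\<lambda>k. g k t) m - 1"
  have bd_dev: "bd (dev k)" for k by (rule approx_bd[OF approx_dev])
  have dev: "approx (dev k) (a k)" for k unfolding a_def by (rule approx_dev)
  have W: "approx W (3 * a (Suc m) + 3 * a m + real (Suc (Suc m)) / 2 + real (Suc m) / 2 + real m / 2 + 0)"
    unfolding W_def
    by (intro approx_add approx_mult approx_const dev approx_G approx_small bd_add bd_mult bd_power bd_dev)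
  have "approx (\<lambda>t. ((\<Sum>k\<le>m. dev k t) - N / 2 * W t) / ?Q t)
     (((\<Sum>k\<le>m. a k) - N / 2 * (3 * a (Suc m) + 3 * a m + real (Suc (Suc m)) / 2 + real (Suc m) / 2 + real m / 2 + 0)) / 2)"
    by (intro approx_divide approx_diff approx_mult approx_const approx_sum dev W approx_offdiag) simp
  moreover have "((\<Sum>k\<le>m. a k) - N / 2 * (3 * a (Suc m) + 3 * a m + real (Suc (Suc m)) / 2 + real (Suc m) / 2 + real m / 2 + 0)) / 2
     = N * (N - 2 * lam) / 4"
    unfolding a_def sum_first_order by (simp add: N_def field_simps)
  ultimately show "approx (\<lambda>t. ((\<Sum>k\<le>m. dev k t) - N / 2 * W t) / ?Q t) (real (Suc m) * (real (Suc m) - 2 * lam) / 4)"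
    by (simp only: N_def)
  have all: "\<forall>\<^sub>F t in F. \<forall>k\<in>{..m}. y k t = 1 + e t * dev k t"
    using y_dev by (intro eventually_ball_finite) auto
  have nz: "\<forall>\<^sub>F t in F. ?Q t \<noteq> 0"
    by (rule tendsto_imp_eventually_ne[OF approx_tendsto[OF approx_offdiag]]) simp
  show "\<forall>\<^sub>F t in F. (G (Suc m) t - real (Suc m) / 2) / e t = ((\<Sum>k\<le>m. dev k t) - N / 2 * W t) / ?Q t"
    using all nz G_offdiag[of m] y_dev[of "Suc m"] g_eq[of m] g_eq[of "Suc m"] g_eq[of "Suc (Suc m)"] e_pos
  proof eventually_elim
    case (elim t)
    have S: "(\<Sum>k\<le>m. y k t) = N + e t * (\<Sum>k\<le>m. dev k t)"
      using elim(1) by (simp add: sum.distrib N_def flip: sum_distrib_left)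
    have ym: "y m t = 1 + e t * dev m t" using elim(1) by blast
    have Q: "?Q t = 2 + e t * W t"
      unfolding cubic_offdiag_def ym elim(4-7) W_def by (simp add: algebra_simps power2_eq_square)
    have "(G (Suc m) t - N / 2) * ?Q t = (\<Sum>k\<le>m. y k t) - N / 2 * (2 + e t * W t)"
      unfolding elim(3) Q by (simp add: algebra_simps)
    also have "\<dots> = ((\<Sum>k\<le>m. dev k t) - N / 2 * W t) * e t"
      unfolding S by (simp add: algebra_simps)
    finally show ?case using elim(2,8) by (simp add: N_def divide_eq_eq eq_divide_eq mult_ac)
  qed
qed

end

section \<open>Recurrence coefficients of the generalised Airy weight\<close>

lemma airy_functional_weight_integral:
  assumes "lam > -1" "monic_orthogonal_polys (gen_airy_weight t lam) P" "recurrence_coeffs P a b"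
  shows "airy_functional (weight_integral t lam) t lam P a b"
proof
  show "weight_integral t lam (P m * P n) = 0" if "m \<noteq> n" for m n
    using assms(2) that unfolding monic_orthogonal_polys_def weight_integral_def by simp
  show "degree (P n) = n" "lead_coeff (P n) = 1" for n
    using assms(2) unfolding monic_orthogonal_polys_def by blast+
  show "weight_integral t lam ([:lam + 1, t, 0, -1:] * p + X * pderiv p) = 0" for p
    using assms(1) by (rule weight_integral_pearson)
qed (use assms in \<open>auto intro: weight_integral_add weight_integral_smult weight_integral_pos\<close>)

locale airy_family =
  fixes lam :: real
    and P :: "real \<Rightarrow> nat \<Rightarrow> real poly"
    and \<alpha> \<beta> :: "nat \<Rightarrow> real \<Rightarrow> real"
  assumes lam: "lam > -1"
    and orthogonal: "\<And>t. monic_orthogonal_polys (gen_airy_weight t lam) (P t)"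
    and recurrence: "\<And>t. recurrence_coeffs (P t) (\<lambda>k. \<alpha> k t) (\<lambda>k. \<beta> k t)"
begin

lemma functional: "airy_functional (weight_integral t lam) t lam (P t) (\<lambda>k. \<alpha> k t) (\<lambda>k. \<beta> k t)"
  by (rule airy_functional_weight_integral[OF lam orthogonal recurrence])

lemmas coeffs_pos = airy_functional.a_pos[OF functional] airy_functional.b_pos[OF functional]
  airy_functional.b_nonneg[OF functional] airy_functional.b_0[OF functional]

lemmas string_diag_at = airy_functional.string_diag[OF functional]

lemmas string_offdiag_at = airy_functional.string_offdiag[OF functional]

section \<open>The expansion for large positive t\<close>

definition s :: "real \<Rightarrow> real" where "s t = 1 / sqrt t"

definition e :: "real \<Rightarrow> real" where "e t = t powr (- 3 / 2)"

definition y :: "nat \<Rightarrow> real \<Rightarrow> real" where "y k t = s t * \<alpha> k t"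

definition g :: "nat \<Rightarrow> real \<Rightarrow> real" where "g k t = (s t)\<^sup>2 * \<beta> k t"

lemma s_props:
  assumes "t > 0"
  shows "s t > 0" "(s t)\<^sup>2 * t = 1" "e t = s t ^ 3"
proof -
  show "s t > 0" "(s t)\<^sup>2 * t = 1" using assms by (simp_all add: s_def power_divide)
  have "s t = t powr (- 1 / 2)" using assms by (simp add: s_def powr_minus_divide flip: powr_half_sqrt)
  then show "e t = s t ^ 3" using assms by (simp add: e_def powr_power)
qed

lemma eventually_positive: "\<forall>\<^sub>F t::real in at_top. t > 0"
  by (rule eventually_gt_at_top)

lemma moments_about_saddle:
  "\<exists>C>0. \<forall>\<^sub>F t in at_top. weight_integral t lam ([:- sqrt t, 1:] ^ k * [:- sqrt t, 1:] ^ k)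
     \<le> C * s t ^ k * weight_integral t lam 1"
proof -
  obtain C where C: "C > 0" "\<forall>\<^sub>F r in at_top.
     weight_integral (r\<^sup>2) lam ([:-r, 1:] ^ k * [:-r, 1:] ^ k) \<le> C * r powr (- real k) * weight_integral (r\<^sup>2) lam 1"
    by (rule weight_integral_concentration[OF lam])
  have "\<forall>\<^sub>F t in at_top. weight_integral ((sqrt t)\<^sup>2) lam ([:- sqrt t, 1:] ^ k * [:- sqrt t, 1:] ^ k)
      \<le> C * sqrt t powr (- real k) * weight_integral ((sqrt t)\<^sup>2) lam 1"
    using eventually_compose_filterlim[OF C(2) sqrt_at_top] .
  then have "\<forall>\<^sub>F t in at_top. weight_integral t lam ([:- sqrt t, 1:] ^ k * [:- sqrt t, 1:] ^ k)
    \<le> C * s t ^ k * weight_integral t lam 1"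
    using eventually_positive by eventually_elim (simp add: s_def powr_minus_divide powr_realpow power_divide)
  then show ?thesis using C(1) by blast
qed

lemma h_0_eq_mass: "airy_functional.h (weight_integral t lam) (P t) 0 = weight_integral t lam 1"
  by (simp add: airy_functional.h_def[OF functional] airy_functional.P_0[OF functional])

lemma mass_pos: "weight_integral t lam 1 > 0"
  using weight_integral_pos[OF lam, of 1] by simp

text \<open>
  The comparison polynomial in \<open>h_minimal\<close> is \<open>(x - sqrt t)\<^sup>k\<close>.
\<close>
lemma prod_beta_upper: "\<exists>C. \<forall>\<^sub>F t in at_top. (\<Prod>i<k. \<beta> (Suc i) t) \<le> C * s t ^ k"
proof -
  obtain C where C: "C > 0" "\<forall>\<^sub>F t in at_top. weight_integral t lam ([:- sqrt t, 1:] ^ k * [:- sqrt t, 1:] ^ k)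
    \<le> C * s t ^ k * weight_integral t lam 1" using moments_about_saddle by blast
  have "\<forall>\<^sub>F t in at_top. (\<Prod>i<k. \<beta> (Suc i) t) \<le> C * s t ^ k"
    using C(2)
  proof eventually_elim
    case (elim t)
    have "degree ([:- sqrt t, 1:] ^ k) = k" "lead_coeff ([:- sqrt t, 1:] ^ k) = 1"
      using lead_coeff_power[of "[:- sqrt t, 1:]" k] by (simp_all add: degree_power_eq)
    from airy_functional.h_minimal[OF functional this, of t]
    have "(\<Prod>i<k. \<beta> (Suc i) t) * weight_integral t lam 1 \<le> C * s t ^ k * weight_integral t lam 1"
      using elim airy_functional.prod_b[OF functional, of t k] by (simp add: h_0_eq_mass)
    then show ?case using mass_pos[of t] by simp
  qed
  then show ?thesis by blast
qed

text \<open>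
  The second moment about \<open>sqrt t\<close> bounds the squared distance of the mean \<open>\<alpha>\<^sub>0\<close> from \<open>sqrt t\<close>.
\<close>
lemma y_0_tendsto: "(y 0 \<longlongrightarrow> 1) at_top"
proof -
  obtain C where C: "C > 0" "\<forall>\<^sub>F t in at_top. weight_integral t lam ([:- sqrt t, 1:] ^ 1 * [:- sqrt t, 1:] ^ 1)
    \<le> C * s t ^ 1 * weight_integral t lam 1" using moments_about_saddle by blast
  have "((\<lambda>t. (y 0 t - 1)\<^sup>2) \<longlongrightarrow> 0) at_top"
  proof (rule Lim_null_comparison)
    show "\<forall>\<^sub>F t in at_top. norm ((y 0 t - 1)\<^sup>2) \<le> C * e t"
      using C(2) eventually_positive
    proof eventually_elim
      case (elim t)
      have "(\<alpha> 0 t - sqrt t)\<^sup>2 * weight_integral t lam 1 \<le> C * s t * weight_integral t lam 1"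
        using airy_functional.mean_deviation[OF functional, of t "sqrt t"] elim(1) by (simp add: h_0_eq_mass)
      then have "(\<alpha> 0 t - sqrt t)\<^sup>2 \<le> C * s t" using mass_pos[of t] by simp
      then have "(s t)\<^sup>2 * (\<alpha> 0 t - sqrt t)\<^sup>2 \<le> (s t)\<^sup>2 * (C * s t)" by (intro mult_left_mono) auto
      moreover have "y 0 t - 1 = s t * (\<alpha> 0 t - sqrt t)"
        using elim(2) by (simp add: y_def s_def field_simps)
      ultimately have "(y 0 t - 1)\<^sup>2 \<le> C * e t" using s_props(3)[OF elim(2)]
        by (simp add: power_mult_distrib power2_eq_square power3_eq_cube mult_ac)
      then show ?case by simp
    qed
    have "((\<lambda>t. C * e t) \<longlongrightarrow> C * 0) at_top" unfolding e_def by (intro tendsto_mult_left) real_asymp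
    then show "((\<lambda>t. C * e t) \<longlongrightarrow> 0) at_top" by simp
  qed
  then have "((\<lambda>t. sqrt ((y 0 t - 1)\<^sup>2)) \<longlongrightarrow> sqrt 0) at_top" by (rule tendsto_real_sqrt)
  then have "((\<lambda>t. y 0 t - 1) \<longlongrightarrow> 0) at_top" by (simp add: tendsto_rabs_zero_iff)
  then show ?thesis by (simp add: LIM_zero_iff)
qed

sublocale scale_top: asymptotic_scale at_top e
proof
  show "(e \<longlongrightarrow> 0) at_top" unfolding e_def by real_asymp
  show "\<forall>\<^sub>F t in at_top. e t > 0" using eventually_positive by eventually_elim (simp add: e_def)
qed

sublocale top: hermite_scaling at_top e y g lam
proof
  show "\<forall>\<^sub>F t in at_top. y k t > 0" for k
    using eventually_positive by eventually_elim (simp add: y_def s_props coeffs_pos)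
  show "\<forall>\<^sub>F t in at_top. g (Suc m) t > 0" for m
    using eventually_positive by eventually_elim (use s_props coeffs_pos in \<open>fastforce simp: g_def\<close>)
  show "\<forall>\<^sub>F t in at_top. g 0 t = 0" by (simp add: g_def coeffs_pos)
  show "\<forall>\<^sub>F t in at_top. cubic_diag (\<lambda>k. y k t) (\<lambda>k. g k t) k - y k t = e t * (2 * real k + lam + 1)" for k
    using eventually_positive
  proof eventually_elim
    case (elim t)
    have "cubic_diag (\<lambda>k. y k t) (\<lambda>k. g k t) k = s t ^ 3 * (t * \<alpha> k t + (2 * real k + lam + 1))"
      unfolding y_def g_def cubic_diag_scale using string_diag_at[of t k] by simp
    also have "\<dots> = ((s t)\<^sup>2 * t) * (s t * \<alpha> k t) + s t ^ 3 * (2 * real k + lam + 1)"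
      by (simp add: algebra_simps power2_eq_square power3_eq_cube)
    finally show ?case using s_props(2,3)[OF elim] by (simp add: y_def)
  qed
  show "\<forall>\<^sub>F t in at_top. e t * (\<Sum>k\<le>m. y k t) + g (Suc m) t =
      g (Suc m) t * cubic_offdiag (\<lambda>k. y k t) (\<lambda>k. g k t) m" for m
    using eventually_positive
  proof eventually_elim
    case (elim t)
    have "g (Suc m) t * cubic_offdiag (\<lambda>k. y k t) (\<lambda>k. g k t) m
        = (s t) ^ 4 * (\<beta> (Suc m) t * cubic_offdiag (\<lambda>k. \<alpha> k t) (\<lambda>k. \<beta> k t) m)"
      unfolding y_def g_def cubic_offdiag_scale by (simp add: power2_eq_square power4_eq_xxxx)
    also have "\<dots> = (s t) ^ 4 * ((\<Sum>k\<le>m. \<alpha> k t) + t * \<beta> (Suc m) t)" by (simp only: string_offdiag_at)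
    also have "\<dots> = e t * (\<Sum>k\<le>m. y k t) + (s t)\<^sup>2 * ((s t)\<^sup>2 * t) * \<beta> (Suc m) t"
      using s_props(3)[OF elim]
      by (simp add: y_def power2_eq_square power3_eq_cube power4_eq_xxxx distrib_left flip: sum_distrib_left)
    also have "\<dots> = e t * (\<Sum>k\<le>m. y k t) + g (Suc m) t" using s_props(2)[OF elim] by (simp add: g_def)
    finally show ?case by simp
  qed
  show "scale_top.bd (\<lambda>t. \<Prod>k<m. g (Suc k) t / e t)" for m
  proof -
    obtain C where C: "\<forall>\<^sub>F t in at_top. (\<Prod>i<m. \<beta> (Suc i) t) \<le> C * s t ^ m" using prod_beta_upper by blast
    show ?thesis
    proof (rule scale_top.bdI)
      show "\<forall>\<^sub>F t in at_top. \<bar>\<Prod>k<m. g (Suc k) t / e t\<bar> \<le> C"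
        using C eventually_positive
      proof eventually_elim
        case (elim t)
        have "g (Suc k) t / e t = \<beta> (Suc k) t / s t" for k
          using s_props(1,3)[OF elim(2)] by (simp add: g_def power2_eq_square power3_eq_cube)
        then have "(\<Prod>k<m. g (Suc k) t / e t) = (\<Prod>k<m. \<beta> (Suc k) t) / s t ^ m"
          by (simp add: prod_dividef)
        moreover have "(\<Prod>k<m. \<beta> (Suc k) t) \<ge> 0" by (intro prod_nonneg) (simp add: coeffs_pos)
        ultimately show ?case using elim(1) s_props(1)[OF elim(2)] by (simp add: divide_le_eq)
      qed
    qed
  qed
qed (rule y_0_tendsto)

lemma alpha_at_top:
  "(\<lambda>t. \<alpha> n t - (sqrt t - (2 * real n - 2 * lam + 1) / (4 * t))) \<in> O[at_top](\<lambda>t. t powr (-5/2))"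
proof -
  have "(\<lambda>t. 1 / t * (top.dev n t - (- (2 * real n - 2 * lam + 1) / 4))) \<in> O[at_top](\<lambda>t. 1 / t * e t)"
    by (intro landau_o.big.mult scale_top.approx_bigo top.approx_dev) simp
  also have "(\<lambda>t::real. 1 / t * e t) \<in> O[at_top](\<lambda>t. t powr (-5/2))"
    unfolding e_def by real_asymp
  finally have "(\<lambda>t. 1 / t * (top.dev n t - (- (2 * real n - 2 * lam + 1) / 4))) \<in> O[at_top](\<lambda>t. t powr (-5/2))" .
  also have "?this \<longleftrightarrow> ((\<lambda>t. \<alpha> n t - (sqrt t - (2 * real n - 2 * lam + 1) / (4 * t))) \<in> O[at_top](\<lambda>t. t powr (-5/2)))"
  proof (rule landau_o.big.in_cong)
    show "\<forall>\<^sub>F t in at_top. 1 / t * (top.dev n t - (- (2 * real n - 2 * lam + 1) / 4)) =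
       \<alpha> n t - (sqrt t - (2 * real n - 2 * lam + 1) / (4 * t))"
      using top.y_dev[of n] eventually_positive
    proof eventually_elim
      case (elim t)
      have "\<alpha> n t = sqrt t * y n t" using elim(2) by (simp add: y_def s_def)
      also have "\<dots> = sqrt t + (sqrt t * e t) * top.dev n t" using elim(1) by (simp add: algebra_simps)
      also have "sqrt t * e t = 1 / t"
        using elim(2) by (simp add: s_props(3)[OF elim(2)] s_def power3_eq_cube)
      finally show ?case using elim(2) by (simp add: field_simps)
    qed
  qed
  finally show "(\<lambda>t. \<alpha> n t - (sqrt t - (2 * real n - 2 * lam + 1) / (4 * t))) \<in> O[at_top](\<lambda>t. t powr (-5/2))" .
qed

lemma beta_at_top:
  "(\<lambda>t. \<beta> n t - (real n / (2 * sqrt t) + real n * (real n - 2 * lam) / (4 * t ^ 2)))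
         \<in> O[at_top](\<lambda>t. t powr (-7/2))"
proof (cases n)
  case 0
  then show ?thesis by (simp add: coeffs_pos)
next
  case (Suc m)
  let ?E = "\<lambda>t. (top.G (Suc m) t - real (Suc m) / 2) / e t"
  have "(\<lambda>t. 1 / t ^ 2 * (?E t - real (Suc m) * (real (Suc m) - 2 * lam) / 4)) \<in> O[at_top](\<lambda>t. 1 / t ^ 2 * e t)"
    by (intro landau_o.big.mult scale_top.approx_bigo top.approx_G_second) simp
  also have "(\<lambda>t::real. 1 / t ^ 2 * e t) \<in> O[at_top](\<lambda>t. t powr (-7/2))"
    unfolding e_def by real_asymp
  finally have "(\<lambda>t. 1 / t ^ 2 * (?E t - real (Suc m) * (real (Suc m) - 2 * lam) / 4)) \<in> O[at_top](\<lambda>t. t powr (-7/2))" .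
  also have "?this \<longleftrightarrow> ?thesis" unfolding Suc
  proof (rule landau_o.big.in_cong)
    show "\<forall>\<^sub>F t in at_top. 1 / t ^ 2 * (?E t - real (Suc m) * (real (Suc m) - 2 * lam) / 4) =
       \<beta> (Suc m) t - (real (Suc m) / (2 * sqrt t) + real (Suc m) * (real (Suc m) - 2 * lam) / (4 * t ^ 2))"
      using top.g_eq[of "Suc m"] eventually_positive scale_top.e_pos
    proof eventually_elim
      case (elim t)
      have te: "t * e t = 1 / sqrt t" "1 / sqrt t * e t = 1 / t ^ 2"
      proof -
        have "t * e t = ((s t)\<^sup>2 * t) * s t" by (simp add: s_props(3)[OF elim(2)] power2_eq_square power3_eq_cube)
        then show "t * e t = 1 / sqrt t" using s_props(2)[OF elim(2)] by (simp add: s_def)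
        show "1 / sqrt t * e t = 1 / t ^ 2"
          using elim(2) by (simp add: s_props(3)[OF elim(2)] s_def power3_eq_cube power2_eq_square)
      qed
      have "\<beta> (Suc m) t = t * g (Suc m) t" using s_props(2)[OF elim(2)] by (simp add: g_def mult_ac)
      also have "\<dots> = t * e t * top.G (Suc m) t" by (simp add: elim(1))
      also have "top.G (Suc m) t = real (Suc m) / 2 + e t * ?E t" using elim(3) by simp
      also have "t * e t * (real (Suc m) / 2 + e t * ?E t) = t * e t * (real (Suc m) / 2) + t * e t * e t * ?E t"
        by (simp only: distrib_left mult.assoc)
      finally have "\<beta> (Suc m) t = 1 / sqrt t * (real (Suc m) / 2) + 1 / t ^ 2 * ?E t" by (simp only: te)
      then show ?case by (simp only: right_diff_distrib) simp
    qed
  qed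
  finally show ?thesis .
qed

section \<open>The expansion for large negative t\<close>

definition A :: "nat \<Rightarrow> real \<Rightarrow> real" where "A k t = (- t) * \<alpha> k t"

definition B :: "nat \<Rightarrow> real \<Rightarrow> real" where "B k t = (- t)\<^sup>2 * \<beta> k t"

definition \<epsilon> :: "real \<Rightarrow> real" where "\<epsilon> t = - 1 / t ^ 3"

lemma eventually_negative: "\<forall>\<^sub>F t::real in at_bot. t < 0"
  unfolding eventually_at_bot_dense by auto

sublocale scale_bot: asymptotic_scale at_bot \<epsilon>
proof
  show "(\<epsilon> \<longlongrightarrow> 0) at_bot" unfolding \<epsilon>_def by real_asymp
  show "\<forall>\<^sub>F t in at_bot. \<epsilon> t > 0" using eventually_negative
    by eventually_elim (simp add: \<epsilon>_def zero_less_divide_iff power3_eq_cube mult_neg_neg mult_pos_neg)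
qed

sublocale bot: laguerre_scaling at_bot \<epsilon> A B lam
proof
  show "\<forall>\<^sub>F t in at_bot. A k t > 0" for k
    using eventually_negative by eventually_elim (use coeffs_pos in \<open>simp add: A_def mult_neg_pos\<close>)
  show "\<forall>\<^sub>F t in at_bot. B k t \<ge> 0" for k by (simp add: B_def coeffs_pos)
  show "\<forall>\<^sub>F t in at_bot. B 0 t = 0" by (simp add: B_def coeffs_pos)
  show "\<forall>\<^sub>F t in at_bot. A k t + \<epsilon> t * cubic_diag (\<lambda>k. A k t) (\<lambda>k. B k t) k = 2 * real k + lam + 1" for k
    using eventually_negative
  proof eventually_elim
    case (elim t)
    then have "\<epsilon> t * (- t) ^ 3 = 1" by (simp add: \<epsilon>_def)
    then have "\<epsilon> t * cubic_diag (\<lambda>k. A k t) (\<lambda>k. B k t) k = cubic_diag (\<lambda>k. \<alpha> k t) (\<lambda>k. \<beta> k t) k"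
      unfolding A_def B_def cubic_diag_scale by (simp only: mult_1 flip: mult.assoc)
    then show ?case using string_diag_at[of t k] by (simp add: A_def)
  qed
  show "\<forall>\<^sub>F t in at_bot. (\<Sum>k\<le>m. A k t) =
     B (Suc m) t + \<epsilon> t * (B (Suc m) t * cubic_offdiag (\<lambda>k. A k t) (\<lambda>k. B k t) m)" for m
    using eventually_negative
  proof eventually_elim
    case (elim t)
    then have *: "\<epsilon> t * (t ^ 4) = - t" by (simp add: \<epsilon>_def power_numeral_reduce)
    have "\<epsilon> t * (B (Suc m) t * cubic_offdiag (\<lambda>k. A k t) (\<lambda>k. B k t) m)
       = (\<epsilon> t * (t ^ 4)) * (\<beta> (Suc m) t * cubic_offdiag (\<lambda>k. \<alpha> k t) (\<lambda>k. \<beta> k t) m)"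
      unfolding A_def B_def cubic_offdiag_scale by (simp add: power2_eq_square power4_eq_xxxx)
    also have "\<dots> = - t * ((\<Sum>k\<le>m. \<alpha> k t) + t * \<beta> (Suc m) t)" by (simp only: * string_offdiag_at)
    finally show ?case
      by (simp add: A_def B_def sum_negf algebra_simps power2_eq_square flip: sum_distrib_left)
  qed
qed

lemma alpha_at_bot:
  "(\<lambda>t. \<alpha> n t - (- ((2 * real n + lam + 1) / t)
      - (2 * real n + lam + 1)
          * (10 * real n ^ 2 + 10 * real n * lam + lam ^ 2 + 10 * real n + 5 * lam + 6) / t ^ 4))
     \<in> O[at_bot](\<lambda>t. 1 / t ^ 7)"
proof -
  define K where "K = (2 * real n + lam + 1)
              * (10 * real n ^ 2 + 10 * real n * lam + lam ^ 2 + 10 * real n + 5 * lam + 6)"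
  have "(\<lambda>t. \<epsilon> t / t * ((A n t - bot.c n) / \<epsilon> t + cubic_diag bot.c bot.D n)) \<in> O[at_bot](\<lambda>t. \<epsilon> t / t * \<epsilon> t)"
    by (intro landau_o.big.mult bot.A_second_order) simp
  also have "(\<lambda>t::real. \<epsilon> t / t * \<epsilon> t) = (\<lambda>t. 1 / t ^ 7)"
    by (simp add: \<epsilon>_def fun_eq_iff power_numeral_reduce)
  finally have "(\<lambda>t. \<epsilon> t / t * ((A n t - bot.c n) / \<epsilon> t + K)) \<in> O[at_bot](\<lambda>t. 1 / t ^ 7)"
    by (simp only: bot.cubic_diag_laguerre K_def)
  then have "(\<lambda>t. - (\<epsilon> t / t * ((A n t - bot.c n) / \<epsilon> t + K))) \<in> O[at_bot](\<lambda>t. 1 / t ^ 7)" by simp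
  also have "?this \<longleftrightarrow> ((\<lambda>t. \<alpha> n t - (- ((2 * real n + lam + 1) / t) - K / t ^ 4)) \<in> O[at_bot](\<lambda>t. 1 / t ^ 7))"
  proof (rule landau_o.big.in_cong)
    show "\<forall>\<^sub>F t in at_bot. - (\<epsilon> t / t * ((A n t - bot.c n) / \<epsilon> t + K)) =
      \<alpha> n t - (- ((2 * real n + lam + 1) / t) - K / t ^ 4)"
      using eventually_negative
    proof eventually_elim
      case (elim t)
      have "\<epsilon> t \<noteq> 0" using elim by (simp add: \<epsilon>_def)
      then have "\<epsilon> t / t * ((A n t - bot.c n) / \<epsilon> t + K) = (A n t - bot.c n) / t + \<epsilon> t / t * K"
        by (simp add: distrib_left)
      also have "\<dots> = - \<alpha> n t - bot.c n / t - K / t ^ 4"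
        using elim by (simp add: A_def \<epsilon>_def diff_divide_distrib power_numeral_reduce)
      finally show ?case by (simp add: bot.c_def)
    qed
  qed
  finally show "(\<lambda>t. \<alpha> n t - (- ((2 * real n + lam + 1) / t)
          - (2 * real n + lam + 1)
              * (10 * real n ^ 2 + 10 * real n * lam + lam ^ 2 + 10 * real n + 5 * lam + 6) / t ^ 4))
         \<in> O[at_bot](\<lambda>t. 1 / t ^ 7)" by (simp only: K_def)
qed

lemma beta_at_bot:
  "(\<lambda>t. \<beta> n t - (real n * (real n + lam) / t ^ 2
          + 4 * real n * (real n + lam) * (5 * real n ^ 2 + 5 * real n * lam + lam ^ 2 + 1) / t ^ 5))
         \<in> O[at_bot](\<lambda>t. 1 / t ^ 8)"
proof (cases n)
  case 0
  then show ?thesis by (simp add: coeffs_pos)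
next
  case (Suc m)
  define K where "K = 4 * real n * (real n + lam) * (5 * real n ^ 2 + 5 * real n * lam + lam ^ 2 + 1)"
  have "(\<lambda>t. \<epsilon> t / t ^ 2 * ((B n t - bot.D n) / \<epsilon> t +
      ((\<Sum>k\<le>m. cubic_diag bot.c bot.D k) + bot.D n * cubic_offdiag bot.c bot.D m)))
      \<in> O[at_bot](\<lambda>t. \<epsilon> t / t ^ 2 * \<epsilon> t)"
    unfolding Suc by (intro landau_o.big.mult bot.B_second_order) simp
  also have "(\<lambda>t::real. \<epsilon> t / t ^ 2 * \<epsilon> t) = (\<lambda>t. 1 / t ^ 8)"
    by (simp add: \<epsilon>_def fun_eq_iff power_numeral_reduce)
  also have "(\<Sum>k\<le>m. cubic_diag bot.c bot.D k) + bot.D n * cubic_offdiag bot.c bot.D m = K"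
    unfolding Suc bot.second_coeff_laguerre K_def ..
  finally have "(\<lambda>t. \<epsilon> t / t ^ 2 * ((B n t - bot.D n) / \<epsilon> t + K)) \<in> O[at_bot](\<lambda>t. 1 / t ^ 8)" .
  also have "?this \<longleftrightarrow> ((\<lambda>t. \<beta> n t - (real n * (real n + lam) / t ^ 2 + K / t ^ 5)) \<in> O[at_bot](\<lambda>t. 1 / t ^ 8))"
  proof (rule landau_o.big.in_cong)
    show "\<forall>\<^sub>F t in at_bot. \<epsilon> t / t ^ 2 * ((B n t - bot.D n) / \<epsilon> t + K) =
      \<beta> n t - (real n * (real n + lam) / t ^ 2 + K / t ^ 5)"
      using eventually_negative
    proof eventually_elim
      case (elim t)
      have "\<epsilon> t \<noteq> 0" using elim by (simp add: \<epsilon>_def)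
      then have "\<epsilon> t / t ^ 2 * ((B n t - bot.D n) / \<epsilon> t + K) = (B n t - bot.D n) / t ^ 2 + \<epsilon> t / t ^ 2 * K"
        by (simp add: distrib_left)
      also have "\<dots> = \<beta> n t - bot.D n / t ^ 2 - K / t ^ 5"
        using elim by (simp add: B_def \<epsilon>_def diff_divide_distrib power_numeral_reduce)
      finally show ?case by (simp add: bot.D_def)
    qed
  qed
  finally show ?thesis by (simp only: K_def)
qed

end

theorem lemma3p16:
  fixes lam :: real
    and P :: "real \<Rightarrow> nat \<Rightarrow> real poly"
    and \<alpha> \<beta> :: "nat \<Rightarrow> real \<Rightarrow> real"
    and n :: nat
  assumes "lam > -1"
    and "\<And>t. monic_orthogonal_polys (gen_airy_weight t lam) (P t)"
    and "\<And>t. recurrence_coeffs (P t) (\<lambda>k. \<alpha> k t) (\<lambda>k. \<beta> k t)"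
  shows "((\<lambda>t. \<alpha> n t - (sqrt t - (2 * real n - 2 * lam + 1) / (4 * t)))
           \<in> O[at_top](\<lambda>t. t powr (-5/2))) \<and>
         ((\<lambda>t. \<beta> n t - (real n / (2 * sqrt t) + real n * (real n - 2 * lam) / (4 * t ^ 2)))
           \<in> O[at_top](\<lambda>t. t powr (-7/2))) \<and>
         ((\<lambda>t. \<alpha> n t - (- ((2 * real n + lam + 1) / t)
            - (2 * real n + lam + 1)
                * (10 * real n ^ 2 + 10 * real n * lam + lam ^ 2 + 10 * real n + 5 * lam + 6) / t ^ 4))
           \<in> O[at_bot](\<lambda>t. 1 / t ^ 7)) \<and>
         ((\<lambda>t. \<beta> n t - (real n * (real n + lam) / t ^ 2
            + 4 * real n * (real n + lam) * (5 * real n ^ 2 + 5 * real n * lam + lam ^ 2 + 1) / t ^ 5))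
           \<in> O[at_bot](\<lambda>t. 1 / t ^ 8))"
proof -
  interpret airy_family lam P \<alpha> \<beta>
    using assms by unfold_locales
  show ?thesis
    by (intro conjI alpha_at_top beta_at_top alpha_at_bot beta_at_bot)
qed

end
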